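(* Let $\phi=\phi(z_\alpha)$ and $z=z_\alpha$. As $n\to\infty$, $$A_n=\frac{a_1}{\sqrt n}+\frac{a_2}{n}+\frac{a_3}{n^{3/2}}+O(n^{-2}),\qquad \tilde A_n=\frac{\tilde a_1}{\sqrt n}+\frac{\tilde a_2}{n}+\frac{\tilde a_3}{n^{3/2}}+O(n^{-2}),$$ where $$a_1=\frac{g(0)}{2f(0)}[\phi-\alpha z],\qquad a_2=\frac{g'(0)}{8f^2(0)}[z\phi-\alpha(z^2+1)]-\frac{g(0)}{2f(0)}\{f_{11}[z\phi+\alpha]+f_{12}\alpha\},$$ $$a_3=\frac{g''(0)}{48f^3(0)}[(z^2+2)\phi-\alpha(z^3+3z)]-\frac{g'(0)}{4f^2(0)}\{f_{11}[\alpha z-2\phi]+f_{12}[\alpha z-\phi]\}-\frac{g(0)}{2f(0)}\{f_{21}(z^4+4z^2+8)\phi+f_{22}(z^2+2)\phi+f_{23}\phi\},$$ $$\tilde a_1=\frac{g(0)}{2f(0)}[(1-\alpha)z+\phi],\qquad \tilde a_2=\frac{g'(0)}{8f^2(0)}[(1-\alpha)(z^2+1)+z\phi]+\frac{g(0)}{2f(0)}\{f_{11}[(1-\alpha)-z\phi]+f_{12}(1-\alpha)\},$$ $$\tilde a_3=\frac{g''(0)}{48f^3(0)}[(z^2+2)\phi+(1-\alpha)(z^3+3z)]+\frac{g'(0)}{4f^2(0)}\{f_{11}[(1-\alpha)z+2\phi]+f_{12}[(1-\alpha)z+\phi]\}-\frac{g(0)}{2f(0)}\{f_{21}(z^4+4z^2+8)\phi+f_{22}(z^2+2)\phi+f_{23}\phi\}.$$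 Consequently, $$\delta_n=\frac{c_1}{\sqrt n}+\frac{c_2}{n}+\frac{c_3}{n^{3/2}}+O(n^{-2}),\qquad \epsilon_n=\frac{d_1}{\sqrt n}+\frac{d_2}{n}+\frac{d_3}{n^{3/2}}+O(n^{-2}),$$ where $$b_1=\frac{z\,g(0)}{2f(0)},\quad b_2=\frac{g'(0)(z^2+1)}{8f^2(0)}+\frac{g(0)(f_{11}+f_{12})}{2f(0)},\quad b_3=\frac{g''(0)(z^3+3z)}{48f^3(0)}+\frac{z\,g'(0)(f_{11}+f_{12})}{4f^2(0)}$$ (so that $b_i=\tilde a_i-a_i$), and $$c_1=\frac{a_1}{\lambda},\quad c_2=\frac{a_1b_1}{\lambda^2}+\frac{a_2}{\lambda},\quad c_3=\frac{a_3}{\lambda}+\frac{a_1b_2+a_2b_1}{\lambda^2}+\frac{a_1b_1^2}{\lambda^3},$$ $$d_1=\frac{\tilde a_1}{1-\lambda},\quad d_2=\frac{\tilde a_2}{1-\lambda}-\frac{\tilde a_1b_1}{(1-\lambda)^2},\quad d_3=\frac{\tilde a_3}{1-\lambda}-\frac{\tilde a_2b_1+\tilde a_1b_2}{(1-\lambda)^2}+\frac{\tilde a_1b_1^2}{(1-\lambda)^3}.$$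
   Context: Location family: given $\theta\in\mathbb R$, $X_1,\ldots,X_n$ are i.i.d. with density $f(x-\theta)$, where $f$ is a density with median $0$ and $f(0)>0$. Fix $0<\alpha<1$. The asymptotic size $\alpha$ test of $H_0:\theta\le0$ versus $H_1:\theta>0$ rejects $H_0$ if $\sqrt n\,T_n>z_\alpha/[2f(0)]$, where $T_n=X_{([n/2]+1)}$ is the sample median (the $([n/2]+1)$-th order statistic). Notation: $\phi(\cdot)$ and $\Phi(\cdot)$ are the standard normal density and CDF, $z_\alpha=\Phi^{-1}(1-\alpha)$, $[x]$ and $\{x\}$ are the integer and fractional parts of $x$, and $$f_{11}=\frac{f'(0)}{4f^2(0)},\quad f_{12}=-(1-2\{\tfrac n2\}),\quad f_{21}=-\frac1{32}\Big[\frac{f'(0)}{f^2(0)}\Big]^2,$$ $$f_{22}=\frac14+\Big(\frac12-\{\tfrac n2\}\Big)\frac{f'(0)}{2f^2(0)}+\frac{f''(0)}{24f^3(0)},\quad f_{23}=\frac14-\frac12(1-2\{\tfrac n2\})^2.$$ (The coefficients thus depend on $n$ only through its parity.) Regularity of $f$: $f$ is smooth enough at $0$ that the CDF $F_n$ of $2f(0)\sqrt n(T_n-\theta)$ (under true parameter $\theta$) has Reiss's expansion $$F_n(t)=\Phi(t)+\frac{\phi(t)}{\sqrt n}(f_{11}t^2+f_{12})+\frac{\phi(t)}{n}(f_{21}t^5+f_{22}t^3+f_{23}t)+r_{t,n},$$ with $r_{t,n}=\phi(t)R_3(t)/n^{3/2}+O(n^{-2})$, where $R_3$ is a polynomial (with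 coefficients bounded in $n$) and the $O(n^{-2})$ is uniform in $t\in\mathbb R$. Prior: $\theta$ has a probability density $g$ on $\mathbb R$ that is three times differentiable with $\sup_\theta|g^{(3)}(\theta)|<\infty$, and $\lambda=P(\theta>0)=\int_0^\infty g(\theta)\,d\theta$ satisfies $0<\lambda<1$. Quantities (joint law of $\theta$ and the data), with $c_n=z_\alpha/[2f(0)]$: $A_n=P(\theta\le0,\sqrt nT_n>c_n)$, $\tilde A_n=P(\theta>0,\sqrt nT_n\le c_n)$, $\delta_n=P(\theta\le0\mid\sqrt nT_n>c_n)$, $\epsilon_n=P(\theta>0\mid\sqrt nT_n\le c_n)$. *)

theory Defs
  imports "HOL-Probability.Probability" "HOL-Library.Landau_Symbols"
    "HOL-Computational_Algebra.Polynomial"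
begin

definition Phi :: "real \<Rightarrow> real" where
  "Phi t = cdf std_normal_distribution t"

definition z_quantile :: "real \<Rightarrow> real" where
  "z_quantile \<alpha> = inv Phi (1 - \<alpha>)"

definition prob_density :: "(real \<Rightarrow> real) \<Rightarrow> bool" where
  "prob_density f \<longleftrightarrow> f \<in> borel_measurable borel \<and> (\<forall>x. 0 \<le> f x) \<and> (\<integral>\<^sup>+x. ennreal (f x) \<partial>lborel) = 1"

text \<open>The observations \<open>X\<^sub>1, \<dots>, X\<^sub>n\<close> are the coordinates \<open>x 0, \<dots>, x (n - 1)\<close>.\<close>

definition sample_law :: "(real \<Rightarrow> real) \<Rightarrow> real \<Rightarrow> nat \<Rightarrow> (nat \<Rightarrow> real) measure" where
  "sample_law f \<theta> n = PiM {..<n} (\<lambda>_. density lborel (\<lambda>x. ennreal (f (x - \<theta>))))"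

text \<open>\<open>order_stat k n x\<close> is the \<open>k\<close>-th smallest of the \<open>n\<close> observations, for \<open>1 \<le> k \<le> n\<close>.\<close>

definition order_stat :: "nat \<Rightarrow> nat \<Rightarrow> (nat \<Rightarrow> real) \<Rightarrow> real" where
  "order_stat k n x = sort (map x [0..<n]) ! (k - 1)"

definition sample_median :: "nat \<Rightarrow> (nat \<Rightarrow> real) \<Rightarrow> real" where
  "sample_median n x = order_stat (n div 2 + 1) n x"

text \<open>Joint law of the parameter and the data: \<open>\<theta>\<close> has density \<open>g\<close> and, given \<open>\<theta>\<close>, the data
  have law \<open>sample_law f \<theta> n\<close>.\<close>

definition joint_law :: "(real \<Rightarrow> real) \<Rightarrow> (real \<Rightarrow> real) \<Rightarrow> nat \<Rightarrow> (real \<times> (nat \<Rightarrow> real)) measure" where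
  "joint_law f g n =
     density lborel (\<lambda>\<theta>. ennreal (g \<theta>)) \<bind>
       (\<lambda>\<theta>. sample_law f \<theta> n \<bind> (\<lambda>x. return (borel \<Otimes>\<^sub>M PiM {..<n} (\<lambda>_. borel)) (\<theta>, x)))"

definition f11 :: "(real \<Rightarrow> real) \<Rightarrow> real" where
  "f11 f = deriv f 0 / (4 * (f 0)\<^sup>2)"

definition f12 :: "nat \<Rightarrow> real" where
  "f12 n = - (1 - 2 * frac (real n / 2))"

definition f21 :: "(real \<Rightarrow> real) \<Rightarrow> real" where
  "f21 f = - (1 / 32) * (deriv f 0 / (f 0)\<^sup>2)\<^sup>2"

definition f22 :: "(real \<Rightarrow> real) \<Rightarrow> nat \<Rightarrow> real" where
  "f22 f n = 1 / 4 + (1 / 2 - frac (real n / 2)) * (deriv f 0 / (2 * (f 0)\<^sup>2))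
               + deriv (deriv f) 0 / (24 * (f 0) ^ 3)"

definition f23 :: "nat \<Rightarrow> real" where
  "f23 n = 1 / 4 - 1 / 2 * (1 - 2 * frac (real n / 2))\<^sup>2"

definition median_cdf :: "(real \<Rightarrow> real) \<Rightarrow> real \<Rightarrow> nat \<Rightarrow> real \<Rightarrow> real" where
  "median_cdf f \<theta> n t = \<P>(x in sample_law f \<theta> n. 2 * f 0 * sqrt (real n) * (sample_median n x - \<theta>) \<le> t)"

text \<open>\<open>R n\<close> is the polynomial \<open>R\<^sub>3\<close>; it may depend on \<open>n\<close>, with bounded degree and coefficients.
  Nothing in the expansion depends on \<open>\<theta>\<close>, since by location equivariance
  \<open>median_cdf f \<theta> n\<close> is the same function for every \<open>\<theta>\<close>.\<close>

definition reiss_expansion :: "(real \<Rightarrow> real) \<Rightarrow> bool" where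
  "reiss_expansion f \<longleftrightarrow>
     (\<exists>(R :: nat \<Rightarrow> real poly) d K C.
        (\<forall>n. degree (R n) \<le> d) \<and> (\<forall>n i. \<bar>coeff (R n) i\<bar> \<le> K) \<and>
        (\<forall>\<^sub>F n in sequentially. \<forall>\<theta> t.
           \<bar>median_cdf f \<theta> n t
             - (Phi t
                + std_normal_density t / sqrt (real n) * (f11 f * t\<^sup>2 + f12 n)
                + std_normal_density t / real n * (f21 f * t ^ 5 + f22 f n * t ^ 3 + f23 n * t)
                + std_normal_density t * poly (R n) t / real n powr (3 / 2))\<bar>
           \<le> C / (real n)\<^sup>2))"

definition crit :: "(real \<Rightarrow> real) \<Rightarrow> real \<Rightarrow> real" where
  "crit f \<alpha> = z_quantile \<alpha> / (2 * f 0)"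

definition prior_alt :: "(real \<Rightarrow> real) \<Rightarrow> real" where
  "prior_alt g = (LBINT \<theta>:{0<..}. g \<theta>)"

definition err_A :: "(real \<Rightarrow> real) \<Rightarrow> (real \<Rightarrow> real) \<Rightarrow> real \<Rightarrow> nat \<Rightarrow> real" where
  "err_A f g \<alpha> n =
     \<P>((\<theta>, x) in joint_law f g n. \<theta> \<le> 0 \<and> sqrt (real n) * sample_median n x > crit f \<alpha>)"

definition err_At :: "(real \<Rightarrow> real) \<Rightarrow> (real \<Rightarrow> real) \<Rightarrow> real \<Rightarrow> nat \<Rightarrow> real" where
  "err_At f g \<alpha> n =
     \<P>((\<theta>, x) in joint_law f g n. \<theta> > 0 \<and> sqrt (real n) * sample_median n x \<le> crit f \<alpha>)"

definition err_delta :: "(real \<Rightarrow> real) \<Rightarrow> (real \<Rightarrow> real) \<Rightarrow> real \<Rightarrow> nat \<Rightarrow> real" where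
  "err_delta f g \<alpha> n =
     \<P>((\<theta>, x) in joint_law f g n. \<theta> \<le> 0 \<bar> sqrt (real n) * sample_median n x > crit f \<alpha>)"

definition err_eps :: "(real \<Rightarrow> real) \<Rightarrow> (real \<Rightarrow> real) \<Rightarrow> real \<Rightarrow> nat \<Rightarrow> real" where
  "err_eps f g \<alpha> n =
     \<P>((\<theta>, x) in joint_law f g n. \<theta> > 0 \<bar> sqrt (real n) * sample_median n x \<le> crit f \<alpha>)"

text \<open>The suffix \<open>t\<close> stands for the tilde.\<close>

definition a1 :: "(real \<Rightarrow> real) \<Rightarrow> (real \<Rightarrow> real) \<Rightarrow> real \<Rightarrow> real" where
  "a1 f g \<alpha> = (let z = z_quantile \<alpha>; \<phi> = std_normal_density z in
     g 0 / (2 * f 0) * (\<phi> - \<alpha> * z))"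

definition a2 :: "(real \<Rightarrow> real) \<Rightarrow> (real \<Rightarrow> real) \<Rightarrow> real \<Rightarrow> nat \<Rightarrow> real" where
  "a2 f g \<alpha> n = (let z = z_quantile \<alpha>; \<phi> = std_normal_density z in
     deriv g 0 / (8 * (f 0)\<^sup>2) * (z * \<phi> - \<alpha> * (z\<^sup>2 + 1))
     - g 0 / (2 * f 0) * (f11 f * (z * \<phi> + \<alpha>) + f12 n * \<alpha>))"

definition a3 :: "(real \<Rightarrow> real) \<Rightarrow> (real \<Rightarrow> real) \<Rightarrow> real \<Rightarrow> nat \<Rightarrow> real" where
  "a3 f g \<alpha> n = (let z = z_quantile \<alpha>; \<phi> = std_normal_density z in
     deriv (deriv g) 0 / (48 * (f 0) ^ 3) * ((z\<^sup>2 + 2) * \<phi> - \<alpha> * (z ^ 3 + 3 * z))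
     - deriv g 0 / (4 * (f 0)\<^sup>2) * (f11 f * (\<alpha> * z - 2 * \<phi>) + f12 n * (\<alpha> * z - \<phi>))
     - g 0 / (2 * f 0) *
         (f21 f * (z ^ 4 + 4 * z\<^sup>2 + 8) * \<phi> + f22 f n * (z\<^sup>2 + 2) * \<phi> + f23 n * \<phi>))"

definition at1 :: "(real \<Rightarrow> real) \<Rightarrow> (real \<Rightarrow> real) \<Rightarrow> real \<Rightarrow> real" where
  "at1 f g \<alpha> = (let z = z_quantile \<alpha>; \<phi> = std_normal_density z in
     g 0 / (2 * f 0) * ((1 - \<alpha>) * z + \<phi>))"

definition at2 :: "(real \<Rightarrow> real) \<Rightarrow> (real \<Rightarrow> real) \<Rightarrow> real \<Rightarrow> nat \<Rightarrow> real" where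
  "at2 f g \<alpha> n = (let z = z_quantile \<alpha>; \<phi> = std_normal_density z in
     deriv g 0 / (8 * (f 0)\<^sup>2) * ((1 - \<alpha>) * (z\<^sup>2 + 1) + z * \<phi>)
     + g 0 / (2 * f 0) * (f11 f * ((1 - \<alpha>) - z * \<phi>) + f12 n * (1 - \<alpha>)))"

definition at3 :: "(real \<Rightarrow> real) \<Rightarrow> (real \<Rightarrow> real) \<Rightarrow> real \<Rightarrow> nat \<Rightarrow> real" where
  "at3 f g \<alpha> n = (let z = z_quantile \<alpha>; \<phi> = std_normal_density z in
     deriv (deriv g) 0 / (48 * (f 0) ^ 3) * ((z\<^sup>2 + 2) * \<phi> + (1 - \<alpha>) * (z ^ 3 + 3 * z))
     + deriv g 0 / (4 * (f 0)\<^sup>2) *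
         (f11 f * ((1 - \<alpha>) * z + 2 * \<phi>) + f12 n * ((1 - \<alpha>) * z + \<phi>))
     - g 0 / (2 * f 0) *
         (f21 f * (z ^ 4 + 4 * z\<^sup>2 + 8) * \<phi> + f22 f n * (z\<^sup>2 + 2) * \<phi> + f23 n * \<phi>))"

definition b1 :: "(real \<Rightarrow> real) \<Rightarrow> (real \<Rightarrow> real) \<Rightarrow> real \<Rightarrow> real" where
  "b1 f g \<alpha> = z_quantile \<alpha> * g 0 / (2 * f 0)"

definition b2 :: "(real \<Rightarrow> real) \<Rightarrow> (real \<Rightarrow> real) \<Rightarrow> real \<Rightarrow> nat \<Rightarrow> real" where
  "b2 f g \<alpha> n = (let z = z_quantile \<alpha> in
     deriv g 0 * (z\<^sup>2 + 1) / (8 * (f 0)\<^sup>2) + g 0 * (f11 f + f12 n) / (2 * f 0))"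

definition b3 :: "(real \<Rightarrow> real) \<Rightarrow> (real \<Rightarrow> real) \<Rightarrow> real \<Rightarrow> nat \<Rightarrow> real" where
  "b3 f g \<alpha> n = (let z = z_quantile \<alpha> in
     deriv (deriv g) 0 * (z ^ 3 + 3 * z) / (48 * (f 0) ^ 3)
     + z * deriv g 0 * (f11 f + f12 n) / (4 * (f 0)\<^sup>2))"

definition c1 :: "(real \<Rightarrow> real) \<Rightarrow> (real \<Rightarrow> real) \<Rightarrow> real \<Rightarrow> real" where
  "c1 f g \<alpha> = a1 f g \<alpha> / prior_alt g"

definition c2 :: "(real \<Rightarrow> real) \<Rightarrow> (real \<Rightarrow> real) \<Rightarrow> real \<Rightarrow> nat \<Rightarrow> real" where
  "c2 f g \<alpha> n = (let l = prior_alt g in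
     a1 f g \<alpha> * b1 f g \<alpha> / l\<^sup>2 + a2 f g \<alpha> n / l)"

definition c3 :: "(real \<Rightarrow> real) \<Rightarrow> (real \<Rightarrow> real) \<Rightarrow> real \<Rightarrow> nat \<Rightarrow> real" where
  "c3 f g \<alpha> n = (let l = prior_alt g in
     a3 f g \<alpha> n / l
     + (a1 f g \<alpha> * b2 f g \<alpha> n + a2 f g \<alpha> n * b1 f g \<alpha>) / l\<^sup>2
     + a1 f g \<alpha> * (b1 f g \<alpha>)\<^sup>2 / l ^ 3)"

definition d1 :: "(real \<Rightarrow> real) \<Rightarrow> (real \<Rightarrow> real) \<Rightarrow> real \<Rightarrow> real" where
  "d1 f g \<alpha> = at1 f g \<alpha> / (1 - prior_alt g)"

definition d2 :: "(real \<Rightarrow> real) \<Rightarrow> (real \<Rightarrow> real) \<Rightarrow> real \<Rightarrow> nat \<Rightarrow> real" where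
  "d2 f g \<alpha> n = (let l = prior_alt g in
     at2 f g \<alpha> n / (1 - l) - at1 f g \<alpha> * b1 f g \<alpha> / (1 - l)\<^sup>2)"

definition d3 :: "(real \<Rightarrow> real) \<Rightarrow> (real \<Rightarrow> real) \<Rightarrow> real \<Rightarrow> nat \<Rightarrow> real" where
  "d3 f g \<alpha> n = (let l = prior_alt g in
     at3 f g \<alpha> n / (1 - l)
     - (at2 f g \<alpha> n * b1 f g \<alpha> + at1 f g \<alpha> * b2 f g \<alpha> n) / (1 - l)\<^sup>2
     + at1 f g \<alpha> * (b1 f g \<alpha>)\<^sup>2 / (1 - l) ^ 3)"

end

theory Submission
  imports Defs
begin

text \<open>
  Write \<open>\<epsilon> = 1 / sqrt n\<close>, \<open>\<kappa> = 2 * f 0\<close> and \<open>z\<close> for the normal quantile. Conditioning on the parameter turns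
  both error probabilities into integrals of the prior against the conditional law of the median
  (\<open>err_A_eq\<close>, \<open>err_At_eq\<close>), and the test accepts at \<open>\<theta>\<close> with probability
  \<open>F\<^sub>n (z - \<kappa> * sqrt n * \<theta>)\<close>, where \<open>F\<^sub>n\<close> is the distribution function of the normalised median. So
  only parameters at distance of order \<open>\<epsilon>\<close> from the boundary \<open>0\<close> contribute: with
  \<open>\<theta> = (z - t) * \<epsilon> / \<kappa>\<close> the prior enters through its Taylor polynomial at \<open>0\<close>, a polynomial in
  \<open>\<epsilon>\<close>, and \<open>F\<^sub>n t\<close> through Reiss's expansion, again in powers of \<open>\<epsilon>\<close>. Multiplying
  out and integrating term by term gives the coefficients as tail moments of the normal density
  and of the normal tail, which are elementary.

  Two points need care. First, the remainder of Reiss's expansion is uniform in \<open>t\<close> but not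
  integrable in \<open>t\<close>; it has to be removed while the integral still runs over \<open>\<theta>\<close>, where the prior is
  integrable. Secondly, everything else that is dropped has to be dominated by \<open>\<epsilon> ^ 3\<close> times one fixed
  integrable function. A Mills-type inequality (\<open>mills_bound\<close>) replaces the normal tail by a
  multiple of the density, so that a polynomial times the density serves
  (\<open>expansion_error_pointwise\<close>); the change of variables supplies the fourth factor \<open>\<epsilon>\<close>.

  Both error probabilities are instances of the single expansion \<open>smoothed_tail_expansion\<close> over
  \<open>u > 0\<close>: for the error of the first kind \<open>u = - \<theta>\<close> and the boundary point is \<open>z\<close>; for the second
  kind \<open>u = \<theta>\<close> and the reflection \<open>t \<mapsto> - t\<close> moves the boundary to \<open>- z\<close> and changes the sign of
  the even correction \<open>f11 f * t\<^sup>2 + f12 n\<close>, while the odd correction of order \<open>1 / n\<close> keeps its sign.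

  Finally, the test rejects with probability \<open>prior_alt g - W n\<close>, where \<open>W n\<close> is the difference of the two
  errors, so that the conditional error probabilities are quotients of
  expansions that are already known, and \<open>ratio_expansion\<close> divides them.
\<close>

section \<open>The standard normal distribution function\<close>

abbreviation phi :: "real \<Rightarrow> real" where "phi \<equiv> std_normal_density"

lemma phi_abs_moment_integrable: "integrable lborel (\<lambda>t. phi t * (1 + \<bar>t\<bar>) ^ N)"
proof -
  have "integrable lborel (\<lambda>t. \<Sum>k\<le>N. of_nat (N choose k) * (phi t * \<bar>t\<bar> ^ k))"
    by (intro Bochner_Integration.integrable_sum integrable_mult_right integrable_std_normal_moment_abs)
  also have "(\<lambda>t. \<Sum>k\<le>N. of_nat (N choose k) * (phi t * \<bar>t\<bar> ^ k)) = (\<lambda>t. phi t * (1 + \<bar>t\<bar>) ^ N)"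
    by (subst add.commute, simp add: binomial_ring sum_distrib_left mult_ac)
  finally show ?thesis .
qed

lemma Phi_diff:
  assumes "a \<le> b" shows "Phi b - Phi a = (LBINT t=a..b. phi t)"
proof (cases "a = b")
  case False
  interpret real_distribution std_normal_distribution by (rule real_dist_normal_dist)
  have "Phi b - Phi a = measure std_normal_distribution {a<..b}"
    using assms False unfolding Phi_def by (intro cdf_diff_eq) auto
  also have "\<dots> = (LBINT t:{a<..b}. phi t)"
    unfolding measure_def set_lebesgue_integral_def
    by (subst emeasure_density)
       (auto simp: integral_eq_nn_integral normal_density_nonneg ennreal_indicator[symmetric]
          ennreal_mult'[symmetric] mult_ac intro!: arg_cong[where f=enn2real] nn_integral_cong
          split: split_indicator)
  also have "\<dots> = (LBINT t=a..b. phi t)"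
    using assms by (simp add: interval_integral_Ioc)
  finally show ?thesis .
qed simp

lemma phi_isCont: "isCont phi t"
  unfolding std_normal_density_def by (intro continuous_intros) auto

lemma Phi_deriv: "(Phi has_real_derivative phi t) (at t)"
proof -
  have "((\<lambda>u. LBINT y=ereal (t-1)..ereal u. phi y) has_vector_derivative phi t) (at t within {t-1..t+1})"
    by (rule interval_integral_FTC2) (auto intro!: continuous_at_imp_continuous_on simp: phi_isCont)
  then have "((\<lambda>u. Phi (t-1) + (LBINT y=ereal (t-1)..ereal u. phi y)) has_real_derivative phi t)
      (at t within {t-1..t+1})"
    by (auto intro!: derivative_eq_intros simp: has_real_derivative_iff_has_vector_derivative)
  then have "(Phi has_real_derivative phi t) (at t within {t-1..t+1})"
    by (rule has_field_derivative_transform_within[where d=1])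
       (auto simp: Phi_diff[symmetric])
  then show ?thesis
    by (subst (asm) at_within_interior) auto
qed

lemma phi_minus: "phi (- t) = phi t"
  by (simp add: std_normal_density_def)

lemma Phi_minus_deriv: "((\<lambda>t. Phi (- t)) has_real_derivative - phi t) (at t)"
proof -
  have "((\<lambda>t. Phi (- t)) has_real_derivative phi (- t) * (- 1)) (at t)"
    by (rule DERIV_chain2[OF Phi_deriv]) (auto intro!: derivative_eq_intros)
  then show ?thesis by (simp add: phi_minus)
qed

lemma phi_deriv: "(phi has_real_derivative - t * phi t) (at t)"
  unfolding std_normal_density_def
  by (auto intro!: derivative_eq_intros simp: field_simps)

lemma Phi_isCont: "isCont Phi t"
  using Phi_deriv by (rule DERIV_isCont)

lemma Phi_measurable [measurable]: "Phi \<in> borel_measurable borel"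
  by (intro borel_measurable_continuous_onI continuous_at_imp_continuous_on ballI Phi_isCont)

lemma Phi_nonneg: "0 \<le> Phi t" and Phi_le_1: "Phi t \<le> 1"
proof -
  interpret real_distribution std_normal_distribution by (rule real_dist_normal_dist)
  show "0 \<le> Phi t" "Phi t \<le> 1"
    unfolding Phi_def by (rule cdf_nonneg, rule cdf_bounded_prob)
qed

lemma Phi_at_top: "(Phi \<longlongrightarrow> 1) at_top"
  and Phi_at_bot: "(Phi \<longlongrightarrow> 0) at_bot"
proof -
  interpret real_distribution std_normal_distribution by (rule real_dist_normal_dist)
  show "(Phi \<longlongrightarrow> 1) at_top" "(Phi \<longlongrightarrow> 0) at_bot"
    unfolding Phi_def[abs_def] by (rule cdf_lim_at_top_prob, rule cdf_lim_at_bot)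
qed

lemma Phi_minus_at_top: "((\<lambda>t. Phi (- t)) \<longlongrightarrow> 0) at_top"
  using Phi_at_bot by (simp add: filterlim_at_bot_mirror)

lemma Phi_minus: "Phi (- t) = 1 - Phi t"
proof -
  have "((\<lambda>t. Phi t + Phi (- t)) has_real_derivative 0) (at s)" for s
    by (rule derivative_eq_intros Phi_deriv Phi_minus_deriv | simp)+
  then obtain c where c: "Phi s + Phi (- s) = c" for s
    using DERIV_isconst_all[of "\<lambda>t. Phi t + Phi (- t)"] by metis
  have "((\<lambda>s. Phi s + Phi (- s)) \<longlongrightarrow> 1 + 0) at_top"
    by (intro tendsto_add Phi_at_top Phi_minus_at_top)
  then have "c = 1" unfolding c by (simp add: tendsto_const_iff)
  with c[of t] show ?thesis by simp
qed

lemma Phi_z_quantile: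
  assumes "0 < \<alpha>" "\<alpha> < 1" shows "Phi (z_quantile \<alpha>) = 1 - \<alpha>"
proof -
  have "eventually (\<lambda>t. Phi t > 1 - \<alpha>) at_top" "eventually (\<lambda>t. Phi t < 1 - \<alpha>) at_bot"
    using assms by (auto intro!: order_tendstoD[OF Phi_at_top] order_tendstoD[OF Phi_at_bot])
  then obtain a b where ab: "\<And>t. t \<ge> b \<Longrightarrow> Phi t > 1 - \<alpha>" "\<And>t. t \<le> a \<Longrightarrow> Phi t < 1 - \<alpha>"
    unfolding eventually_at_top_linorder eventually_at_bot_linorder by metis
  have "\<exists>x. min a b \<le> x \<and> x \<le> max a b \<and> Phi x = 1 - \<alpha>"
    using ab[of "max a b"] ab(2)[of "min a b"] Phi_isCont
    by (intro IVT) (auto simp: less_imp_le)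
  then have "1 - \<alpha> \<in> range Phi" by (metis rangeI)
  then show ?thesis unfolding z_quantile_def by (rule f_inv_into_f)
qed

lemma phi_poly_at_top: "((\<lambda>t. t ^ k * phi t) \<longlongrightarrow> 0) at_top"
proof (rule Lim_null_comparison)
  show "((\<lambda>t::real. exp (1/2) * (t ^ k / exp t)) \<longlongrightarrow> 0) at_top"
    by (rule tendsto_mult_right_zero tendsto_power_div_exp_0)+
  show "\<forall>\<^sub>F t in at_top. norm (t ^ k * phi t) \<le> exp (1/2) * (t ^ k / exp t)"
  proof (rule eventually_at_top_linorderI[of 0])
    fix t :: real assume "0 \<le> t"
    have "(1 / sqrt (2 * pi)) * exp (- t\<^sup>2 / 2) \<le> 1 * exp (1/2 - t)"
    proof (rule mult_mono)
      have "sqrt 1 \<le> sqrt (2 * pi)"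
        using pi_ge_two by (intro real_sqrt_le_mono) simp
      then show "1 / sqrt (2 * pi) \<le> 1" by (simp add: divide_le_eq)
      show "exp (- t\<^sup>2 / 2) \<le> exp (1/2 - t)"
        using zero_le_power2[of "t - 1"] by (simp add: power2_eq_square algebra_simps)
    qed auto
    then have "phi t \<le> exp (1/2) / exp t"
      by (simp add: std_normal_density_def exp_diff)
    then show "norm (t ^ k * phi t) \<le> exp (1/2) * (t ^ k / exp t)"
      using \<open>0 \<le> t\<close> mult_left_mono[of "phi t" "exp (1/2) / exp t" "t ^ k"]
      by (simp add: abs_mult mult_ac)
  qed
qed

text \<open>For \<open>t \<ge> 1\<close> the difference of density and tail decreases, because its derivative is
  \<open>(1 - t) * phi t\<close>, and it tends to \<open>0\<close>, so it is nonnegative. On the remaining bounded part of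
  the half-line the density is bounded below and the tail is at most \<open>1\<close>.\<close>

lemma mills_bound: "\<exists>C\<ge>0. \<forall>t\<ge>w. Phi (- t) \<le> C * phi t"
proof -
  define m where "m = max \<bar>w\<bar> 1"
  have phi_le_1: "phi t \<le> 1" for t
  proof -
    have "sqrt 1 \<le> sqrt (2 * pi)"
      using pi_ge_two by (intro real_sqrt_le_mono) simp
    then have "1 / sqrt (2 * pi) * exp (- t\<^sup>2 / 2) \<le> 1 * 1"
      by (intro mult_mono) (auto simp: divide_le_eq)
    then show ?thesis by (simp add: std_normal_density_def)
  qed
  have m: "0 < phi m" "phi m \<le> 1" by (auto simp: normal_density_pos phi_le_1)
  have *: "Phi (- t) \<le> phi t" if "t \<ge> 1" for t
  proof -
    have "phi s - Phi (- s) \<le> phi t - Phi (- t)" if "s \<ge> t" for s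
    proof (rule DERIV_nonpos_imp_nonincreasing[OF that])
      fix x assume x: "t \<le> x" "x \<le> s"
      have "((\<lambda>s. phi s - Phi (- s)) has_real_derivative (- x * phi x - - phi x)) (at x)"
        by (intro DERIV_diff phi_deriv Phi_minus_deriv)
      moreover have "- x * phi x - - phi x \<le> 0"
        using x \<open>t \<ge> 1\<close> mult_right_mono[of 1 x "phi x"] by (simp add: normal_density_nonneg)
      ultimately show "\<exists>y. ((\<lambda>s. phi s - Phi (- s)) has_real_derivative y) (at x) \<and> y \<le> 0"
        by blast
    qed
    then have ev: "\<forall>\<^sub>F s in at_top. phi s - Phi (- s) \<le> phi t - Phi (- t)"
      by (rule eventually_at_top_linorderI)
    have "((\<lambda>s. phi s - Phi (- s)) \<longlongrightarrow> 0 - 0) at_top"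
      using phi_poly_at_top[of 0] by (intro tendsto_diff Phi_minus_at_top) simp
    from tendsto_upperbound[OF this ev] show ?thesis by simp
  qed
  \<comment> \<open>\<open>m\<close> is chosen so that \<open>phi m\<close> is a lower bound of the density between \<open>w\<close> and \<open>1\<close>\<close>
  show ?thesis
  proof (intro exI[of _ "1 / phi m"] conjI allI impI)
    show "0 \<le> 1 / phi m" by (simp add: normal_density_nonneg)
    fix t assume "t \<ge> w"
    show "Phi (- t) \<le> 1 / phi m * phi t"
    proof (cases "t \<ge> 1")
      case True
      have "Phi (- t) \<le> 1 * phi t" using * True by simp
      also have "\<dots> \<le> 1 / phi m * phi t"
        using m by (intro mult_right_mono) (auto simp: normal_density_nonneg field_simps)
      finally show ?thesis .
    next
      case False
      then have "\<bar>t\<bar> \<le> \<bar>m\<bar>" using \<open>t \<ge> w\<close> by (auto simp: m_def)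
      then have "t\<^sup>2 \<le> m\<^sup>2" by (simp only: abs_le_square_iff)
      then have "phi m \<le> phi t" unfolding std_normal_density_def
        by (intro mult_left_mono) auto
      then have "1 \<le> 1 / phi m * phi t" using m by (simp add: field_simps)
      then show ?thesis using Phi_le_1[of "- t"] by linarith
    qed
  qed
qed

text \<open>Domination by a polynomial times the density is what makes the improper integral converge;
  both families of moments below are of this form, so that exhibiting an antiderivative that vanishes
  at infinity suffices.\<close>

lemma tail_FTC:
  fixes F f :: "real \<Rightarrow> real"
  assumes F: "\<And>t. (F has_real_derivative f t) (at t)" and cont: "\<And>t. isCont f t"
    and bd: "\<And>t. t \<ge> w \<Longrightarrow> \<bar>f t\<bar> \<le> C * (phi t * (1 + \<bar>t\<bar>) ^ N)"
    and lim: "(F \<longlongrightarrow> 0) at_top"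
  shows "has_bochner_integral lborel (\<lambda>t. indicator {w<..} t * f t) (- F w)"
proof -
  have [measurable]: "f \<in> borel_measurable borel"
    by (intro borel_measurable_continuous_onI continuous_at_imp_continuous_on ballI cont)
  have int: "integrable lborel (\<lambda>t. indicator {w<..} t * f t)"
  proof (rule Bochner_Integration.integrable_bound)
    show "integrable lborel (\<lambda>t. C * (phi t * (1 + \<bar>t\<bar>) ^ N))"
      by (intro integrable_mult_right phi_abs_moment_integrable)
    show "AE t in lborel. norm (indicator {w<..} t * f t) \<le> norm (C * (phi t * (1 + \<bar>t\<bar>) ^ N))"
    proof (rule AE_I2)
      fix t
      show "norm (indicator {w<..} t * f t) \<le> norm (C * (phi t * (1 + \<bar>t\<bar>) ^ N))"
        using bd[of t] by (cases "w < t") auto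
    qed
  qed measurable
  have ei: "einterval (ereal w) \<infinity> = {w<..}" by (auto simp: einterval_def)
  have "(LBINT x=ereal w..\<infinity>. f x) = 0 - F w"
  proof (rule interval_integral_FTC_integrable)
    show "(F has_vector_derivative f x) (at x)" for x
      using F has_real_derivative_iff_has_vector_derivative by blast
    show "set_integrable lborel (einterval (ereal w) \<infinity>) f"
      using int by (simp add: set_integrable_def ei)
    show "((F \<circ> real_of_ereal) \<longlongrightarrow> F w) (at_right (ereal w))"
      unfolding ereal_tendsto_simps
      using DERIV_isCont[OF F[of w]] by (auto simp: isCont_def intro: tendsto_within_subset)
    show "((F \<circ> real_of_ereal) \<longlongrightarrow> 0) (at_left \<infinity>)"
      unfolding ereal_tendsto_simps using lim .
  qed (auto simp: cont)
  then have "(LBINT t. indicator {w<..} t * f t) = - F w"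
    by (simp add: interval_lebesgue_integral_def ei set_lebesgue_integral_def)
  with int show ?thesis by (simp add: has_bochner_integral_iff)
qed

section \<open>Tail moments of the normal density and of the normal tail\<close>

lemma phi_tail_FTC:
  assumes "\<And>t. (F has_real_derivative t ^ k * phi t) (at t)" and "(F \<longlongrightarrow> 0) at_top"
  shows "has_bochner_integral lborel (\<lambda>t. indicator {w<..} t * (t ^ k * phi t)) (- F w)"
proof (rule tail_FTC[where C = 1 and N = k])
  show "isCont (\<lambda>t. t ^ k * phi t) t" for t
    by (intro continuous_intros phi_isCont)
  show "\<bar>t ^ k * phi t\<bar> \<le> 1 * (phi t * (1 + \<bar>t\<bar>) ^ k)" for t
    by (auto simp: abs_mult power_abs normal_density_nonneg mult.commute[of _ "phi t"]
          intro!: mult_left_mono power_mono)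
qed (use assms in auto)

lemma Phi_poly_at_top: "((\<lambda>t. t ^ k * Phi (- t)) \<longlongrightarrow> 0) at_top"
proof -
  obtain C where C: "C \<ge> 0" "\<And>t. t \<ge> 0 \<Longrightarrow> Phi (- t) \<le> C * phi t"
    using mills_bound[of 0] by blast
  show ?thesis
  proof (rule Lim_null_comparison)
    show "((\<lambda>t. C * (t ^ k * phi t)) \<longlongrightarrow> 0) at_top"
      by (rule tendsto_mult_right_zero phi_poly_at_top)+
    show "\<forall>\<^sub>F t in at_top. norm (t ^ k * Phi (- t)) \<le> C * (t ^ k * phi t)"
      using C mult_left_mono[OF C(2), of _ "_ ^ k"]
      by (intro eventually_at_top_linorderI[of 0]) (auto simp: abs_mult Phi_nonneg mult_ac)
  qed
qed

lemma Phi_tail_FTC: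
  assumes "\<And>t. (F has_real_derivative t ^ k * Phi (- t)) (at t)" and "(F \<longlongrightarrow> 0) at_top"
  shows "has_bochner_integral lborel (\<lambda>t. indicator {w<..} t * (t ^ k * Phi (- t))) (- F w)"
proof -
  obtain C where C: "C \<ge> 0" "\<And>t. t \<ge> w \<Longrightarrow> Phi (- t) \<le> C * phi t"
    using mills_bound[of w] by blast
  show ?thesis
  proof (rule tail_FTC[where C = C and N = k])
    show "isCont (\<lambda>t. t ^ k * Phi (- t)) t" for t
      using DERIV_isCont[OF Phi_minus_deriv] by (intro continuous_intros) auto
    show "\<bar>t ^ k * Phi (- t)\<bar> \<le> C * (phi t * (1 + \<bar>t\<bar>) ^ k)" if "t \<ge> w" for t
    proof -
      have "\<bar>t\<bar> ^ k * Phi (- t) \<le> (1 + \<bar>t\<bar>) ^ k * (C * phi t)"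
        using C that by (intro mult_mono power_mono) (auto simp: Phi_nonneg)
      then show ?thesis by (simp add: abs_mult power_abs Phi_nonneg mult_ac)
    qed
  qed (use assms in auto)
qed

text \<open>The antiderivatives come from integrating by parts with \<open>t * phi t = - phi' t\<close>, which
  leads from order \<open>k\<close> to order \<open>k - 2\<close>.\<close>

lemma phi_tail_moments:
  defines "I k w \<equiv> (\<lambda>t. indicator {w<..} t * (t ^ k * phi t))"
  shows "has_bochner_integral lborel (I 0 w) (Phi (- w))"
    and "has_bochner_integral lborel (I 1 w) (phi w)"
    and "has_bochner_integral lborel (I 2 w) (w * phi w + Phi (- w))"
    and "has_bochner_integral lborel (I 3 w) ((w\<^sup>2 + 2) * phi w)"
    and "has_bochner_integral lborel (I 5 w) ((w ^ 4 + 4 * w\<^sup>2 + 8) * phi w)"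
proof -
  note lim = tendsto_minus[OF tendsto_add[OF tendsto_add[OF phi_poly_at_top[of 4]
      tendsto_mult_right_zero[OF phi_poly_at_top[of 2], of 4]]
      tendsto_mult_right_zero[OF phi_poly_at_top[of 0], of 8]]]
    tendsto_minus[OF tendsto_add[OF phi_poly_at_top[of 2]
      tendsto_mult_right_zero[OF phi_poly_at_top[of 0], of 2]]]
    tendsto_minus[OF tendsto_add[OF phi_poly_at_top[of 1] Phi_minus_at_top]]
    tendsto_minus[OF phi_poly_at_top[of 0]] tendsto_minus[OF Phi_minus_at_top]
  have "has_bochner_integral lborel (I 0 w) (- (- Phi (- w)))" unfolding I_def
    by (rule phi_tail_FTC) (use lim in \<open>auto intro!: derivative_eq_intros Phi_minus_deriv\<close>)
  then show "has_bochner_integral lborel (I 0 w) (Phi (- w))" by simp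
  have "has_bochner_integral lborel (I 1 w) (- (- phi w))" unfolding I_def
    by (rule phi_tail_FTC) (use lim in \<open>auto intro!: derivative_eq_intros phi_deriv\<close>)
  then show "has_bochner_integral lborel (I 1 w) (phi w)" by simp
  have "has_bochner_integral lborel (I 2 w) (- (- (w * phi w + Phi (- w))))" unfolding I_def
    by (rule phi_tail_FTC)
       (use lim in \<open>auto intro!: derivative_eq_intros phi_deriv Phi_minus_deriv simp: algebra_simps power2_eq_square\<close>)
  then show "has_bochner_integral lborel (I 2 w) (w * phi w + Phi (- w))" by (simp only: minus_minus)
  have "has_bochner_integral lborel (I 3 w) (- (- ((w\<^sup>2 + 2) * phi w)))" unfolding I_def
    by (rule phi_tail_FTC)
       (use lim in \<open>auto intro!: derivative_eq_intros phi_deriv simp: algebra_simps power2_eq_square power3_eq_cube\<close>)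
  then show "has_bochner_integral lborel (I 3 w) ((w\<^sup>2 + 2) * phi w)" by simp
  have "has_bochner_integral lborel (I 5 w) (- (- ((w ^ 4 + 4 * w\<^sup>2 + 8) * phi w)))" unfolding I_def
    by (rule phi_tail_FTC)
       (use lim in \<open>auto intro!: derivative_eq_intros phi_deriv simp: algebra_simps eval_nat_numeral\<close>)
  then show "has_bochner_integral lborel (I 5 w) ((w ^ 4 + 4 * w\<^sup>2 + 8) * phi w)" by simp
qed

text \<open>Integration by parts reduces these to the moments of the density one order higher.\<close>

lemma Phi_tail_moments:
  defines "J k w \<equiv> (\<lambda>t. indicator {w<..} t * (t ^ k * Phi (- t)))"
  shows "has_bochner_integral lborel (J 0 w) (phi w - w * Phi (- w))"
    and "has_bochner_integral lborel (J 1 w) ((w * phi w + Phi (- w) - w\<^sup>2 * Phi (- w)) / 2)"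
    and "has_bochner_integral lborel (J 2 w) (((w\<^sup>2 + 2) * phi w - w ^ 3 * Phi (- w)) / 3)"
proof -
  note lim = tendsto_diff[OF Phi_poly_at_top[of 1] phi_poly_at_top[of 0]]
    tendsto_divide[OF tendsto_diff[OF Phi_poly_at_top[of 2] tendsto_add[OF phi_poly_at_top[of 1] Phi_minus_at_top]]
      tendsto_const[of 2]]
    tendsto_divide[OF tendsto_diff[OF Phi_poly_at_top[of 3] tendsto_add[OF phi_poly_at_top[of 2]
      tendsto_mult_right_zero[OF phi_poly_at_top[of 0], of 2]]]
      tendsto_const[of 3]]
  have "has_bochner_integral lborel (J 0 w) (- (w * Phi (- w) - phi w))" unfolding J_def
    by (rule Phi_tail_FTC) (use lim in \<open>auto intro!: derivative_eq_intros phi_deriv Phi_minus_deriv\<close>)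
  then show "has_bochner_integral lborel (J 0 w) (phi w - w * Phi (- w))" by simp
  have "has_bochner_integral lborel (J 1 w) (- ((w\<^sup>2 * Phi (- w) - (w * phi w + Phi (- w))) / 2))"
    unfolding J_def
    by (rule Phi_tail_FTC) (use lim in \<open>auto intro!: derivative_eq_intros phi_deriv Phi_minus_deriv
          simp: field_simps power2_eq_square\<close>)
  then show "has_bochner_integral lborel (J 1 w) ((w * phi w + Phi (- w) - w\<^sup>2 * Phi (- w)) / 2)"
    by (simp only: minus_divide_left minus_diff_eq)
  have "has_bochner_integral lborel (J 2 w) (- ((w ^ 3 * Phi (- w) - (w\<^sup>2 + 2) * phi w) / 3))"
    unfolding J_def
    by (rule Phi_tail_FTC) (use lim in \<open>auto intro!: derivative_eq_intros phi_deriv Phi_minus_deriv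
          simp: field_simps power2_eq_square power3_eq_cube\<close>)
  then show "has_bochner_integral lborel (J 2 w) (((w\<^sup>2 + 2) * phi w - w ^ 3 * Phi (- w)) / 3)"
    by (simp only: minus_divide_left minus_diff_eq)
qed

section \<open>A smoothed normal tail\<close>

text \<open>The integrand keeps exactly the terms of the product of the Taylor polynomial with the
  expansion of the tail that are of order at most \<open>\<epsilon>\<^sup>2\<close>, with \<open>e = \<epsilon>\<close> and \<open>r = \<epsilon> / \<kappa>\<close>. Sorting it by
  powers of \<open>t\<close> makes its integral a combination of the tail moments.\<close>

lemma truncated_product_integral:
  fixes w r e h0 h1 h2 a11 a12 a21 a22 a23 :: real
  defines "P \<equiv> phi w" and "T \<equiv> Phi (- w)"
  shows "has_bochner_integral lborel
    (\<lambda>t. indicator {w<..} t *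
       (Phi (- t) * (h0 + h1 * (r * (t - w)) + h2 / 2 * (r * (t - w))\<^sup>2)
        - phi t * (e * (a11 * t\<^sup>2 + a12) * (h0 + h1 * (r * (t - w)))
                   + e\<^sup>2 * (a21 * t ^ 5 + a22 * t ^ 3 + a23 * t) * h0)))
    (h0 * (P - w * T) + r * (h1 / 2 * (T * (w\<^sup>2 + 1) - w * P))
      - e * h0 * (a11 * (w * P + T) + a12 * T)
      + r\<^sup>2 * (h2 / 6 * ((w\<^sup>2 + 2) * P - T * (w ^ 3 + 3 * w)))
      - e * r * h1 * (a11 * (2 * P - w * T) + a12 * (P - w * T))
      - e\<^sup>2 * h0 * (a21 * (w ^ 4 + 4 * w\<^sup>2 + 8) * P + a22 * (w\<^sup>2 + 2) * P + a23 * P))"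
proof -
  note I = phi_tail_moments[of w, folded P_def T_def]
  note J = Phi_tail_moments[of w, folded P_def T_def]
  note B = has_bochner_integral_diff[OF has_bochner_integral_add[OF has_bochner_integral_add[OF
      has_bochner_integral_mult_right[OF J(1), where c = "h0 - h1 * r * w + h2 * r\<^sup>2 * w\<^sup>2 / 2"]
      has_bochner_integral_mult_right[OF J(2), where c = "h1 * r - h2 * r\<^sup>2 * w"]]
      has_bochner_integral_mult_right[OF J(3), where c = "h2 * r\<^sup>2 / 2"]]
    has_bochner_integral_add[OF has_bochner_integral_add[OF has_bochner_integral_add[OF has_bochner_integral_add[OF
      has_bochner_integral_mult_right[OF I(1), where c = "e * a12 * (h0 - h1 * r * w)"]
      has_bochner_integral_mult_right[OF I(2), where c = "e * a12 * h1 * r + e\<^sup>2 * a23 * h0"]]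
      has_bochner_integral_mult_right[OF I(3), where c = "e * a11 * (h0 - h1 * r * w)"]]
      has_bochner_integral_mult_right[OF I(4), where c = "e * a11 * h1 * r + e\<^sup>2 * a22 * h0"]]
      has_bochner_integral_mult_right[OF I(5), where c = "e\<^sup>2 * a21 * h0"]]]
  show ?thesis
    by (rule has_bochner_integral_cong[THEN iffD1, OF refl _ _ B])
       (auto simp: field_simps power2_eq_square power3_eq_cube indicator_def; algebra)+
qed

text \<open>The dropped terms pair each Taylor remainder of \<open>h\<close> with the correction of complementary
  order. As \<open>u\<close> is at most \<open>e\<close> times a multiple \<open>Y\<close> of \<open>1 + \<bar>t\<bar>\<close>, the remainder
  after \<open>j\<close> terms is of size \<open>e ^ j * Y ^ 3\<close>, so that every pair carries a factor \<open>e ^ 3\<close>.\<close>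

lemma expansion_error_pointwise:
  fixes w t e \<kappa> h0 h1 h2 M K :: real and h :: "real \<Rightarrow> real"
  defines "u \<equiv> e / \<kappa> * (t - w)" and "X \<equiv> 1 + \<bar>t\<bar>"
  defines "D \<equiv> 1 + (1 + \<bar>w\<bar>) / \<kappa>" and "H \<equiv> \<bar>h0\<bar> + \<bar>h1\<bar> + \<bar>h2\<bar> + M"
  assumes taylor: "\<And>v. 0 \<le> v \<Longrightarrow> \<bar>h v - (h0 + h1 * v + h2 / 2 * v\<^sup>2)\<bar> \<le> M * v ^ 3"
    and "\<kappa> > 0" "0 < e" "e \<le> 1" "t \<ge> w" "M \<ge> 0" "K \<ge> 0"
    and mills: "Phi (- t) \<le> C * phi t"
    and p: "\<bar>p1\<bar> \<le> K * X ^ d" "\<bar>p2\<bar> \<le> K * X ^ d" "\<bar>p3\<bar> \<le> K * X ^ d"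
  shows "\<bar>h u * (Phi (- t) - phi t * (e * p1 + e\<^sup>2 * p2 + e ^ 3 * p3))
      - (Phi (- t) * (h0 + h1 * u + h2 / 2 * u\<^sup>2)
         - phi t * (e * p1 * (h0 + h1 * u) + e\<^sup>2 * p2 * h0))\<bar>
    \<le> e ^ 3 * (H * D ^ 3 * (C + 3 * K) * (phi t * X ^ (3 + d)))"
    (is "\<bar>?L\<bar> \<le> _")
proof -
  define Y where "Y = D * X"
  have X1: "X \<ge> 1" by (simp add: X_def)
  have D1: "D \<ge> 1" using \<open>\<kappa> > 0\<close> by (simp add: D_def)
  have "Y \<ge> 1 * 1" unfolding Y_def using X1 D1 by (intro mult_mono) auto
  then have Y1: "Y \<ge> 1" by simp
  have u0: "0 \<le> u" using assms(6-9) by (simp add: u_def)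
  have "t - w \<le> (1 + \<bar>w\<bar>) * X"
    by (simp add: X_def algebra_simps) (smt (verit) mult_nonneg_nonneg abs_ge_zero)
  then have "(t - w) / \<kappa> \<le> (1 + \<bar>w\<bar>) / \<kappa> * X"
    using \<open>\<kappa> > 0\<close> divide_right_mono[of "t - w" _ \<kappa>] by simp
  also have "\<dots> \<le> Y" unfolding Y_def D_def using X1 by (simp add: algebra_simps)
  finally have "e * ((t - w) / \<kappa>) \<le> e * Y"
    using \<open>0 < e\<close> by (intro mult_left_mono) auto
  then have uY: "u \<le> e * Y" by (simp add: u_def)
  have pw: "u ^ j \<le> e ^ i * Y ^ 3" if "i \<le> j" "j \<le> 3" for i j
  proof -
    have "u ^ j \<le> (e * Y) ^ j" using u0 uY by (intro power_mono) auto
    also have "\<dots> = e ^ j * Y ^ j" by (rule power_mult_distrib)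
    also have "\<dots> \<le> e ^ i * Y ^ 3"
      using that Y1 \<open>0 < e\<close> \<open>e \<le> 1\<close> by (intro mult_mono power_decreasing power_increasing) auto
    finally show ?thesis .
  qed
  have scale: "c * u ^ j \<le> c * (e ^ i * Y ^ 3)" if "i \<le> j" "j \<le> 3" "c \<ge> 0" for i j c
    using pw[OF that(1,2)] that(3) by (rule mult_left_mono)
  have q: "\<bar>h u - (h0 + h1 * u + h2 / 2 * u\<^sup>2)\<bar> \<le> M * u ^ 3" by (rule taylor[OF u0])
  have h2': "\<bar>h2 / 2 * u\<^sup>2\<bar> \<le> \<bar>h2\<bar> * u ^ 2" and h1': "\<bar>h1 * u\<bar> = \<bar>h1\<bar> * u ^ 1"
    and h0': "\<bar>h0\<bar> = \<bar>h0\<bar> * u ^ 0"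
    using u0 by (auto simp: abs_mult)
  have e1: "\<bar>h u - (h0 + h1 * u + h2 / 2 * u\<^sup>2)\<bar> \<le> H * (e ^ 3 * Y ^ 3)"
  proof -
    have "M * (e ^ 3 * Y ^ 3) \<le> H * (e ^ 3 * Y ^ 3)"
      using Y1 \<open>0 < e\<close> by (intro mult_right_mono) (auto simp: H_def)
    then show ?thesis using q scale[of 3 3 M] \<open>M \<ge> 0\<close> by simp
  qed
  have e2: "\<bar>h u - (h0 + h1 * u)\<bar> \<le> H * (e ^ 2 * Y ^ 3)"
  proof -
    have "\<bar>h u - (h0 + h1 * u)\<bar> \<le> \<bar>h2\<bar> * u ^ 2 + M * u ^ 3" using q h2' by linarith
    also have "\<dots> \<le> \<bar>h2\<bar> * (e ^ 2 * Y ^ 3) + M * (e ^ 2 * Y ^ 3)"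
      using \<open>M \<ge> 0\<close> by (intro add_mono scale) auto
    also have "\<dots> = (\<bar>h2\<bar> + M) * (e ^ 2 * Y ^ 3)" by (simp add: algebra_simps)
    also have "\<dots> \<le> H * (e ^ 2 * Y ^ 3)"
      using Y1 \<open>0 < e\<close> by (intro mult_right_mono) (auto simp: H_def)
    finally show ?thesis .
  qed
  have e3: "\<bar>h u - h0\<bar> \<le> H * (e * Y ^ 3)"
  proof -
    have "\<bar>h u - h0\<bar> \<le> \<bar>h1\<bar> * u ^ 1 + \<bar>h2\<bar> * u ^ 2 + M * u ^ 3" using q h2' h1' by linarith
    also have "\<dots> \<le> \<bar>h1\<bar> * (e ^ 1 * Y ^ 3) + \<bar>h2\<bar> * (e ^ 1 * Y ^ 3) + M * (e ^ 1 * Y ^ 3)"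
      using \<open>M \<ge> 0\<close> by (intro add_mono scale) auto
    also have "\<dots> = (\<bar>h1\<bar> + \<bar>h2\<bar> + M) * (e * Y ^ 3)" by (simp add: algebra_simps)
    also have "\<dots> \<le> H * (e * Y ^ 3)"
      using Y1 \<open>0 < e\<close> by (intro mult_right_mono) (auto simp: H_def)
    finally show ?thesis .
  qed
  have e4: "\<bar>h u\<bar> \<le> H * Y ^ 3"
  proof -
    have "\<bar>h u\<bar> \<le> \<bar>h0\<bar> * u ^ 0 + \<bar>h1\<bar> * u ^ 1 + \<bar>h2\<bar> * u ^ 2 + M * u ^ 3"
      using q h2' h1' h0' by linarith
    also have "\<dots> \<le> \<bar>h0\<bar> * (e ^ 0 * Y ^ 3) + \<bar>h1\<bar> * (e ^ 0 * Y ^ 3) + \<bar>h2\<bar> * (e ^ 0 * Y ^ 3)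
        + M * (e ^ 0 * Y ^ 3)"
      using \<open>M \<ge> 0\<close> by (intro add_mono scale) auto
    also have "\<dots> = H * Y ^ 3" by (simp add: algebra_simps H_def)
    finally show ?thesis .
  qed
  have "?L = Phi (- t) * (h u - (h0 + h1 * u + h2 / 2 * u\<^sup>2))
      - phi t * (e * p1 * (h u - (h0 + h1 * u)) + e\<^sup>2 * p2 * (h u - h0) + e ^ 3 * p3 * h u)"
    by (simp add: algebra_simps)
  also have "\<bar>\<dots>\<bar> \<le> Phi (- t) * \<bar>h u - (h0 + h1 * u + h2 / 2 * u\<^sup>2)\<bar>
      + phi t * (e * \<bar>p1\<bar> * \<bar>h u - (h0 + h1 * u)\<bar> + e\<^sup>2 * \<bar>p2\<bar> * \<bar>h u - h0\<bar> + e ^ 3 * \<bar>p3\<bar> * \<bar>h u\<bar>)"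
  proof -
    have a: "\<bar>x * y - z * (a + b + c)\<bar> \<le> x * \<bar>y\<bar> + z * (\<bar>a\<bar> + \<bar>b\<bar> + \<bar>c\<bar>)"
      if "x \<ge> 0" "z \<ge> 0" for x y z a b c :: real
    proof -
      have "\<bar>x * y - z * (a + b + c)\<bar> \<le> \<bar>x * y\<bar> + \<bar>z * (a + b + c)\<bar>" by linarith
      also have "\<dots> \<le> x * \<bar>y\<bar> + z * (\<bar>a\<bar> + \<bar>b\<bar> + \<bar>c\<bar>)"
        using that by (auto simp: abs_mult intro!: mult_left_mono)
      finally show ?thesis .
    qed
    show ?thesis
      by (rule order_trans[OF a[OF Phi_nonneg normal_density_nonneg]])
         (use \<open>0 < e\<close> in \<open>simp add: abs_mult\<close>)
  qed
  also have "\<dots> \<le> (C * phi t) * (H * (e ^ 3 * Y ^ 3))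
      + phi t * (e * (K * X ^ d) * (H * (e ^ 2 * Y ^ 3)) + e\<^sup>2 * (K * X ^ d) * (H * (e * Y ^ 3))
          + e ^ 3 * (K * X ^ d) * (H * Y ^ 3))"
  proof (intro add_mono mult_left_mono)
    have KX: "0 \<le> K * X ^ d" using \<open>K \<ge> 0\<close> X1 by simp
    have prod: "e ^ i * \<bar>q\<bar> * y \<le> e ^ i * (K * X ^ d) * b" if "\<bar>q\<bar> \<le> K * X ^ d" "0 \<le> y" "y \<le> b"
      for q y b i
      using that KX \<open>0 < e\<close> by (intro mult_mono) auto
    show "Phi (- t) * \<bar>h u - (h0 + h1 * u + h2 / 2 * u\<^sup>2)\<bar> \<le> (C * phi t) * (H * (e ^ 3 * Y ^ 3))"
      using mills e1 order_trans[OF Phi_nonneg mills] by (rule mult_mono) simp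
    show "e * \<bar>p1\<bar> * \<bar>h u - (h0 + h1 * u)\<bar> \<le> e * (K * X ^ d) * (H * (e ^ 2 * Y ^ 3))"
      using prod[OF p(1) _ e2, of 1] by simp
    show "e\<^sup>2 * \<bar>p2\<bar> * \<bar>h u - h0\<bar> \<le> e\<^sup>2 * (K * X ^ d) * (H * (e * Y ^ 3))"
      by (rule prod[OF p(2) _ e3]) simp
    show "e ^ 3 * \<bar>p3\<bar> * \<bar>h u\<bar> \<le> e ^ 3 * (K * X ^ d) * (H * Y ^ 3)"
      by (rule prod[OF p(3) _ e4]) simp
  qed (rule normal_density_nonneg)
  also have "\<dots> = e ^ 3 * (H * Y ^ 3 * phi t) * (C * 1 + 3 * K * X ^ d)"
    by (simp add: algebra_simps power2_eq_square power3_eq_cube)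
  also have "\<dots> \<le> e ^ 3 * (H * Y ^ 3 * phi t) * (C * X ^ d + 3 * K * X ^ d)"
  proof -
    have "0 \<le> C * phi t" using order_trans[OF Phi_nonneg mills] .
    then have "0 \<le> C" using normal_density_pos[of 1 0 t] by (simp add: zero_le_mult_iff)
    then show ?thesis
      using X1 Y1 \<open>0 < e\<close> \<open>M \<ge> 0\<close>
      by (intro mult_left_mono add_right_mono mult_nonneg_nonneg)
         (auto simp: H_def normal_density_nonneg)
  qed
  also have "\<dots> = e ^ 3 * (H * D ^ 3 * (C + 3 * K) * (phi t * X ^ (3 + d)))"
    by (simp add: Y_def power_mult_distrib power_add algebra_simps)
  finally show ?thesis .
qed

text \<open>At \<open>n = 0\<close> both sides vanish, since division by \<open>0\<close> yields \<open>0\<close>; hence the conversion to powers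
  of \<open>\<epsilon>\<close> is an unconditional rewrite rule.\<close>

lemma inverse_sqrt_powers:
  fixes x :: real and n :: nat
  defines "e \<equiv> 1 / sqrt (real n)"
  shows "x / sqrt (real n) = x * e" "x / real n = x * e\<^sup>2"
    "x / real n powr (3/2) = x * e ^ 3" "x / (real n)\<^sup>2 = x * e ^ 4"
proof -
  have e2: "1 / real n = e\<^sup>2" by (simp add: e_def power_divide)
  have e4: "1 / (real n)\<^sup>2 = e ^ 4"
  proof -
    have "e ^ 4 = (e\<^sup>2)\<^sup>2" by (simp flip: power_mult)
    then show ?thesis unfolding e2[symmetric] by (simp add: power_divide)
  qed
  have e3: "1 / real n powr (3/2) = e ^ 3"
  proof (cases "n = 0")
    case False
    have "real n powr (3/2) = (real n powr (1/2)) powr real 3" by (simp add: powr_powr)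
    also have "\<dots> = sqrt (real n) ^ 3"
      using False by (subst powr_realpow) (auto simp: powr_half_sqrt)
    finally show ?thesis by (simp add: e_def power_divide)
  qed (simp add: e_def)
  show "x / sqrt (real n) = x * e" by (simp add: e_def)
  show "x / real n = x * e\<^sup>2" unfolding e2[symmetric] by simp
  show "x / real n powr (3/2) = x * e ^ 3" unfolding e3[symmetric] by simp
  show "x / (real n)\<^sup>2 = x * e ^ 4" unfolding e4[symmetric] by simp
qed

text \<open>In the application \<open>h\<close> is the prior or its reflection and \<open>Q n u\<close> the
  probability of a wrong decision when the parameter is at distance \<open>u\<close> from \<open>0\<close>. The proof compares
  \<open>Q n\<close> with its expansion \<open>H\<close> under the integral over \<open>u\<close>, where the integrability of \<open>h\<close>
  absorbs the uniform error, then substitutes \<open>t = w + \<kappa> * sqrt n * u\<close> and replaces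
  \<open>h * H\<close> by the truncated product \<open>Mn\<close>.\<close>

lemma smoothed_tail_expansion:
  fixes w :: real and h :: "real \<Rightarrow> real" and Q :: "nat \<Rightarrow> real \<Rightarrow> real" and p3 :: "nat \<Rightarrow> real \<Rightarrow> real"
  defines "P \<equiv> phi w" and "T \<equiv> Phi (- w)"
  assumes h: "integrable lborel h" "\<And>u. 0 \<le> h u"
    and taylor: "\<And>v. 0 \<le> v \<Longrightarrow> \<bar>h v - (h0 + h1 * v + h2 / 2 * v\<^sup>2)\<bar> \<le> M * v ^ 3" "M \<ge> 0"
    and \<kappa>: "\<kappa> > 0"
    and a: "\<And>n. \<bar>a12 n\<bar> \<le> K" "\<And>n. \<bar>a22 n\<bar> \<le> K" "\<And>n. \<bar>a23 n\<bar> \<le> K"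
    and p3: "\<And>n t. \<bar>p3 n t\<bar> \<le> K * (1 + \<bar>t\<bar>) ^ d" "\<And>n. p3 n \<in> borel_measurable borel"
    and Q: "\<And>n u. n \<ge> 1 \<Longrightarrow> 0 \<le> Q n u" "\<And>n u. n \<ge> 1 \<Longrightarrow> Q n u \<le> 1"
      "\<And>n. n \<ge> 1 \<Longrightarrow> Q n \<in> borel_measurable borel"
    and approx: "\<forall>\<^sub>F n in sequentially. \<forall>t. \<forall>u\<ge>0. t = w + \<kappa> * sqrt (real n) * u \<longrightarrow>
      \<bar>Q n u - (Phi (- t) - phi t * ((a11 * t\<^sup>2 + a12 n) / sqrt (real n)
          + (a21 * t ^ 5 + a22 n * t ^ 3 + a23 n * t) / real n
          + p3 n t / real n powr (3 / 2)))\<bar> \<le> C / (real n)\<^sup>2"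
  shows "(\<lambda>n. (LBINT u. indicator {0<..} u * (h u * Q n u))
      - (h0 / \<kappa> * (P - w * T) / sqrt (real n)
         + (h1 / (2 * \<kappa>\<^sup>2) * (T * (w\<^sup>2 + 1) - w * P)
            - h0 / \<kappa> * (a11 * (w * P + T) + a12 n * T)) / real n
         + (h2 / (6 * \<kappa> ^ 3) * ((w\<^sup>2 + 2) * P - T * (w ^ 3 + 3 * w))
            - h1 / \<kappa>\<^sup>2 * (a11 * (2 * P - w * T) + a12 n * (P - w * T))
            - h0 / \<kappa> * (a21 * (w ^ 4 + 4 * w\<^sup>2 + 8) * P + a22 n * (w\<^sup>2 + 2) * P + a23 n * P))
           / real n powr (3 / 2)))
    \<in> O(\<lambda>n. 1 / (real n)\<^sup>2)"
proof -
  obtain C1 where C1: "C1 \<ge> 0" "\<And>t. t \<ge> w \<Longrightarrow> Phi (- t) \<le> C1 * phi t"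
    using mills_bound[of w] by blast
  define L where "L = \<bar>a11\<bar> + \<bar>a21\<bar> + 2 * K"
  define N where "N = d + 5"
  define B where "B = (\<bar>h0\<bar> + \<bar>h1\<bar> + \<bar>h2\<bar> + M) * (1 + (1 + \<bar>w\<bar>) / \<kappa>) ^ 3 * (C1 + 3 * L)"
  define G where "G = (\<lambda>t. phi t * (1 + \<bar>t\<bar>) ^ (3 + N))"
  define p1 where "p1 = (\<lambda>n t. a11 * t\<^sup>2 + a12 n)"
  define p2 where "p2 = (\<lambda>n t. a21 * t ^ 5 + a22 n * t ^ 3 + a23 n * t)"
  have K0: "K \<ge> 0" using a(1)[of 0] by linarith
  have L0: "L \<ge> 0" using K0 by (simp add: L_def)
  have G: "integrable lborel G" unfolding G_def by (rule phi_abs_moment_integrable)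
  have G0: "G t \<ge> 0" for t by (simp add: G_def normal_density_nonneg)
  have monom: "\<bar>c * t ^ j\<bar> \<le> b * (1 + \<bar>t\<bar>) ^ N" if "\<bar>c\<bar> \<le> b" "j \<le> 5" for c b t :: real and j
  proof -
    have "\<bar>t\<bar> ^ j \<le> (1 + \<bar>t\<bar>) ^ j" by (intro power_mono) auto
    also have "\<dots> \<le> (1 + \<bar>t\<bar>) ^ N" using that by (intro power_increasing) (auto simp: N_def)
    finally show ?thesis using that by (auto simp: abs_mult power_abs intro!: mult_mono)
  qed
  have bp1: "\<bar>p1 n t\<bar> \<le> L * (1 + \<bar>t\<bar>) ^ N" for n t
  proof -
    have "\<bar>p1 n t\<bar> \<le> \<bar>a11\<bar> * (1 + \<bar>t\<bar>) ^ N + K * (1 + \<bar>t\<bar>) ^ N"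
      using monom[of a11 "\<bar>a11\<bar>" 2 t] monom[OF a(1)[of n], of 0 t] by (simp add: p1_def)
    also have "\<dots> \<le> L * (1 + \<bar>t\<bar>) ^ N"
      unfolding distrib_right[symmetric] using K0 by (intro mult_right_mono) (auto simp: L_def)
    finally show ?thesis .
  qed
  have bp2: "\<bar>p2 n t\<bar> \<le> L * (1 + \<bar>t\<bar>) ^ N" for n t
  proof -
    have "\<bar>p2 n t\<bar> \<le> \<bar>a21\<bar> * (1 + \<bar>t\<bar>) ^ N + K * (1 + \<bar>t\<bar>) ^ N + K * (1 + \<bar>t\<bar>) ^ N"
      using monom[of a21 "\<bar>a21\<bar>" 5 t] monom[OF a(2)[of n], of 3 t] monom[OF a(3)[of n], of 1 t]
      unfolding p2_def by (simp only: power_one_right) linarith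
    also have "\<dots> \<le> L * (1 + \<bar>t\<bar>) ^ N"
      unfolding distrib_right[symmetric] using K0 by (intro mult_right_mono) (auto simp: L_def)
    finally show ?thesis .
  qed
  have bp3: "\<bar>p3 n t\<bar> \<le> L * (1 + \<bar>t\<bar>) ^ N" for n t
  proof -
    have "K * (1 + \<bar>t\<bar>) ^ d \<le> L * (1 + \<bar>t\<bar>) ^ N"
      using K0 by (intro mult_mono power_increasing) (auto simp: L_def N_def)
    with p3(1)[of n t] show ?thesis by linarith
  qed
  have [measurable]: "h \<in> borel_measurable borel" "\<And>n. p3 n \<in> borel_measurable borel"
    "\<And>n. p1 n \<in> borel_measurable borel" "\<And>n. p2 n \<in> borel_measurable borel"
    using h(1) p3(2) by (auto simp: p1_def p2_def)
  define A where "A = (\<lambda>n. LBINT u. indicator {0<..} u * (h u * Q n u))"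
  define c1 where "c1 = h0 / \<kappa> * (P - w * T)"
  define c2 where "c2 = (\<lambda>n. h1 / (2 * \<kappa>\<^sup>2) * (T * (w\<^sup>2 + 1) - w * P)
            - h0 / \<kappa> * (a11 * (w * P + T) + a12 n * T))"
  define c3 where "c3 = (\<lambda>n. h2 / (6 * \<kappa> ^ 3) * ((w\<^sup>2 + 2) * P - T * (w ^ 3 + 3 * w))
            - h1 / \<kappa>\<^sup>2 * (a11 * (2 * P - w * T) + a12 n * (P - w * T))
            - h0 / \<kappa> * (a21 * (w ^ 4 + 4 * w\<^sup>2 + 8) * P + a22 n * (w\<^sup>2 + 2) * P + a23 n * P))"
  define E where "E = C * integral\<^sup>L lborel h + B * integral\<^sup>L lborel G / \<kappa>"
  have "\<forall>\<^sub>F n in sequentially. norm (A n - (c1 / sqrt (real n) + c2 n / real n + c3 n / real n powr (3/2)))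
      \<le> E * norm (1 / (real n)\<^sup>2)"
    using approx eventually_ge_at_top[of 1]
  proof eventually_elim
    case (elim n)
    define e where "e = 1 / sqrt (real n)"
    have n: "real n \<ge> 1" using elim by simp
    have e: "0 < e" "e \<le> 1" using n by (auto simp: e_def)
    note e_powers = inverse_sqrt_powers[where n = n, folded e_def]
    define H where "H = (\<lambda>t. Phi (- t) - phi t * (e * p1 n t + e\<^sup>2 * p2 n t + e ^ 3 * p3 n t))"
    have [measurable]: "H \<in> borel_measurable borel" unfolding H_def by measurable
    have [measurable]: "Q n \<in> borel_measurable borel" using Q(3) elim by simp
    have QH: "\<bar>Q n u - H (w + \<kappa> / e * u)\<bar> \<le> C * e ^ 4" if "u \<ge> 0" for u
    proof -
      have "sqrt (real n) = 1 / e" by (simp add: e_def)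
      then show ?thesis
        using elim(1)[rule_format, OF that refl]
        by (simp only: e_powers) (simp add: H_def p1_def p2_def mult_ac)
    qed
    define Mn where "Mn t = Phi (- t) * (h0 + h1 * (e / \<kappa> * (t - w)) + h2 / 2 * (e / \<kappa> * (t - w))\<^sup>2)
        - phi t * (e * (a11 * t\<^sup>2 + a12 n) * (h0 + h1 * (e / \<kappa> * (t - w)))
                   + e\<^sup>2 * (a21 * t ^ 5 + a22 n * t ^ 3 + a23 n * t) * h0)" for t
    note main = truncated_product_integral[of w h0 h1 "e / \<kappa>" h2 e a11 "a12 n" a21 "a22 n" "a23 n",
        folded Mn_def P_def T_def]
    define D where "D = (\<lambda>t. indicator {w<..} t * (h (e / \<kappa> * (t - w)) * H t) - indicator {w<..} t * Mn t)"
    have D: "\<bar>D t\<bar> \<le> e ^ 3 * (B * G t)" for t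
    proof (cases "t > w")
      case True
      then show ?thesis
        unfolding D_def H_def Mn_def B_def G_def
        using expansion_error_pointwise[where w = w and t = t,
            OF taylor(1) \<kappa> e _ taylor(2) L0 C1(2) bp1[of n t] bp2[of n t] bp3[of n t]]
        by (simp add: p1_def p2_def mult_ac)
    next
      case False
      have "0 \<le> B * G t" unfolding B_def using C1 L0 taylor(2) \<kappa> G0
        by (intro mult_nonneg_nonneg zero_le_power) auto
      then show ?thesis using False e by (simp add: D_def)
    qed
    have D_int: "integrable lborel D"
    proof (rule Bochner_Integration.integrable_bound)
      show "integrable lborel (\<lambda>t. e ^ 3 * (B * G t))" using G by simp
      show "D \<in> borel_measurable lborel" unfolding D_def Mn_def by measurable
    qed (use D in \<open>auto intro!: AE_I2 intro: order_trans[OF _ abs_ge_self]\<close>)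
    have D_bound: "\<bar>integral\<^sup>L lborel D\<bar> \<le> e ^ 3 * (B * integral\<^sup>L lborel G)"
    proof -
      have "\<bar>integral\<^sup>L lborel D\<bar> \<le> (LBINT t. \<bar>D t\<bar>)"
        by (rule integral_abs_bound)
      also have "\<dots> \<le> (LBINT t. e ^ 3 * (B * G t))"
        using D_int G D by (intro integral_mono) auto
      finally show ?thesis by simp
    qed
    have hH_eq: "indicator {w<..} t * (h (e / \<kappa> * (t - w)) * H t) = D t + indicator {w<..} t * Mn t" for t
      by (simp add: D_def)
    have hH_int: "integrable lborel (\<lambda>t. indicator {w<..} t * (h (e / \<kappa> * (t - w)) * H t))"
      unfolding hH_eq using D_int main by (auto simp: has_bochner_integral_iff)
    have hH_val: "(LBINT t. indicator {w<..} t * (h (e / \<kappa> * (t - w)) * H t))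
       = integral\<^sup>L lborel D + (LBINT t. indicator {w<..} t * Mn t)"
      unfolding hH_eq using D_int main by (subst Bochner_Integration.integral_add) (auto simp: has_bochner_integral_iff)
    define F where "F = (\<lambda>u. indicator {0<..} u * (h u * H (w + \<kappa> / e * u)))"
    have ek: "e / \<kappa> > 0" using e \<kappa> by simp
    have subst: "F (- (e / \<kappa> * w) + e / \<kappa> * t) = indicator {w<..} t * (h (e / \<kappa> * (t - w)) * H t)" for t
    proof -
      have "- (e / \<kappa> * w) + e / \<kappa> * t = e / \<kappa> * (t - w)"
        using right_diff_distrib[of "e / \<kappa>" t w] by linarith
      moreover have "(e / \<kappa> * (t - w) > 0) = (t > w)"
        using ek by (simp only: zero_less_mult_iff) auto
      moreover have "w + \<kappa> / e * (e / \<kappa> * (t - w)) = t" using e \<kappa> by simp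
      ultimately show ?thesis by (simp only: F_def indicator_def greaterThan_iff)
    qed
    have F_int: "integrable lborel F"
    proof -
      have "integrable lborel (\<lambda>t. F (- (e / \<kappa> * w) + e / \<kappa> * t))"
        unfolding subst by (rule hH_int)
      then show ?thesis using ek by (subst (asm) lborel_integrable_real_affine_iff) auto
    qed
    \<comment> \<open>the Jacobian \<open>e / \<kappa>\<close> raises the error from third to fourth order\<close>
    have F_val: "integral\<^sup>L lborel F = e / \<kappa> * (integral\<^sup>L lborel D + (LBINT t. indicator {w<..} t * Mn t))"
    proof -
      have "e / \<kappa> \<noteq> 0" using ek by linarith
      from lborel_integral_real_affine[OF this, of F "- (e / \<kappa> * w)"] show ?thesis
        unfolding subst hH_val real_scaleR_def abs_of_pos[OF ek] .
    qed
    have Q_int: "integrable lborel (\<lambda>u. indicator {0<..} u * (h u * Q n u))"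
    proof (rule Bochner_Integration.integrable_bound[OF h(1)])
      show "AE u in lborel. norm (indicator {0<..} u * (h u * Q n u)) \<le> norm (h u)"
        using Q(1,2)[of n] elim(2) h(2)
        by (auto intro!: AE_I2 mult_left_le simp: indicator_def abs_mult)
    qed measurable
    \<comment> \<open>the uniform error is integrated against \<open>h\<close>, before the change of variables\<close>
    have AF: "\<bar>A n - integral\<^sup>L lborel F\<bar> \<le> C * e ^ 4 * integral\<^sup>L lborel h"
    proof -
      have "\<bar>A n - integral\<^sup>L lborel F\<bar> = \<bar>LBINT u. indicator {0<..} u * (h u * Q n u) - F u\<bar>"
        using Q_int F_int by (simp add: A_def)
      also have "\<dots> \<le> (LBINT u. \<bar>indicator {0<..} u * (h u * Q n u) - F u\<bar>)"
        by (rule integral_abs_bound)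
      also have "\<dots> \<le> (LBINT u. C * e ^ 4 * h u)"
      proof (rule integral_mono)
        fix u
        have "0 \<le> C * e ^ 4" using QH[of 0] by linarith
        show "\<bar>indicator {0<..} u * (h u * Q n u) - F u\<bar> \<le> C * e ^ 4 * h u"
        proof (cases "u > 0")
          case True
          then have "\<bar>indicator {0<..} u * (h u * Q n u) - F u\<bar> = h u * \<bar>Q n u - H (w + \<kappa> / e * u)\<bar>"
            using h(2)[of u] by (simp add: F_def right_diff_distrib[symmetric] abs_mult)
          also have "\<dots> \<le> h u * (C * e ^ 4)" using True QH h(2) by (intro mult_left_mono) auto
          finally show ?thesis by (simp add: mult_ac)
        qed (use h(2) \<open>0 \<le> C * e ^ 4\<close> in \<open>auto simp: F_def\<close>)
      qed (use Q_int F_int h(1) in auto)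
      finally show ?thesis by simp
    qed
    have FM: "\<bar>integral\<^sup>L lborel F - e / \<kappa> * (LBINT t. indicator {w<..} t * Mn t)\<bar>
        \<le> e ^ 4 * (B * integral\<^sup>L lborel G / \<kappa>)"
    proof -
      have "\<bar>integral\<^sup>L lborel F - e / \<kappa> * (LBINT t. indicator {w<..} t * Mn t)\<bar>
          = e / \<kappa> * \<bar>integral\<^sup>L lborel D\<bar>"
        unfolding F_val distrib_left using e \<kappa> by (simp add: abs_mult)
      also have "\<dots> \<le> e / \<kappa> * (e ^ 3 * (B * integral\<^sup>L lborel G))"
        using ek D_bound by (intro mult_left_mono) auto
      finally show ?thesis by (simp add: eval_nat_numeral mult_ac)
    qed
    have "e / \<kappa> * (LBINT t. indicator {w<..} t * Mn t) = c1 * e + c2 n * e\<^sup>2 + c3 n * e ^ 3"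
      unfolding has_bochner_integral_integral_eq[OF main] c1_def c2_def c3_def
      using \<kappa> by (simp add: field_simps power2_eq_square power3_eq_cube)
    then have "\<bar>A n - (c1 / sqrt (real n) + c2 n / real n + c3 n / real n powr (3/2))\<bar>
        \<le> C * e ^ 4 * integral\<^sup>L lborel h + e ^ 4 * (B * integral\<^sup>L lborel G / \<kappa>)"
      unfolding e_powers
      using AF FM by linarith
    also have "\<dots> = E * norm (1 / (real n)\<^sup>2)"
      unfolding e_powers using e by (simp add: E_def algebra_simps)
    finally show ?case by simp
  qed
  then show ?thesis
    unfolding A_def c1_def c2_def c3_def by (rule bigoI)
qed

section \<open>The joint law of the parameter and the sample\<close>

lemma sorted_nth_le_iff:
  fixes ys :: "real list"
  assumes "sorted ys" "k < length ys"
  shows "ys ! k \<le> t \<longleftrightarrow> k < length (filter (\<lambda>y. y \<le> t) ys)"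
  using assms
proof (induction ys arbitrary: k)
  case (Cons y ys)
  show ?case
  proof (cases "y \<le> t")
    case True
    with Cons show ?thesis by (cases k) auto
  next
    case False
    with Cons.prems(1) have "filter (\<lambda>y. y \<le> t) (y # ys) = []"
      by (auto simp: filter_empty_conv)
    moreover have "y \<le> (y # ys) ! k"
      using Cons.prems by (cases k) auto
    ultimately show ?thesis using False by simp
  qed
qed simp

text \<open>Counting the observations up to \<open>t\<close> describes the order statistic by its coordinates, which
  gives its measurability.\<close>

lemma order_stat_le_iff:
  assumes "1 \<le> k" "k \<le> n"
  shows "order_stat k n x \<le> t \<longleftrightarrow> k \<le> (\<Sum>i<n. of_bool (x i \<le> t))"
proof -
  have *: "length (filter (\<lambda>y. y \<le> t) (map x [0..<m])) = (\<Sum>i<m. of_bool (x i \<le> t))" for m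
    by (induction m) auto
  have "order_stat k n x \<le> t \<longleftrightarrow> k - 1 < length (filter (\<lambda>y. y \<le> t) (sort (map x [0..<n])))"
    unfolding order_stat_def using assms by (intro sorted_nth_le_iff) auto
  also have "\<dots> \<longleftrightarrow> k \<le> (\<Sum>i<n. of_bool (x i \<le> t))"
    unfolding filter_sort length_sort * using assms(1) by linarith
  finally show ?thesis .
qed

lemma sample_median_measurable:
  assumes "n \<ge> 1"
  shows "sample_median n \<in> borel_measurable (PiM {..<n} (\<lambda>_. borel :: real measure))"
  unfolding borel_measurable_iff_le
proof
  fix t :: real
  have k: "1 \<le> n div 2 + 1" "n div 2 + 1 \<le> n" using assms by auto
  have [measurable]: "(\<lambda>x. x i \<le> t) \<in> measurable (PiM {..<n} (\<lambda>_. borel :: real measure)) (count_space UNIV)"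
    if "i \<in> {..<n}" for i
    by (rule measurable_compose[OF measurable_component_singleton[OF that]]) measurable
  have "Measurable.pred (PiM {..<n} (\<lambda>_. borel :: real measure))
      (\<lambda>x. real (n div 2 + 1) \<le> (\<Sum>i<n. of_bool (x i \<le> t)))"
    by measurable
  also have "(\<lambda>x. real (n div 2 + 1) \<le> (\<Sum>i<n. of_bool (x i \<le> t)))
      = (\<lambda>x. sample_median n x \<le> t)"
  proof
    fix x :: "nat \<Rightarrow> real"
    have "real (n div 2 + 1) \<le> real (\<Sum>i<n. of_bool (x i \<le> t)) \<longleftrightarrow> sample_median n x \<le> t"
      unfolding sample_median_def order_stat_le_iff[OF k] of_nat_le_iff ..
    then show "(real (n div 2 + 1) \<le> (\<Sum>i<n. of_bool (x i \<le> t))) = (sample_median n x \<le> t)"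
      by simp
  qed
  finally show "{x \<in> space (PiM {..<n} (\<lambda>_. borel :: real measure)). sample_median n x \<le> t}
      \<in> sets (PiM {..<n} (\<lambda>_. borel))"
    by (simp add: pred_def)
qed

lemma prob_space_density_lborel:
  assumes "prob_density f"
  shows "prob_space (density lborel (\<lambda>x. ennreal (f x)))"
  using assms by (intro prob_spaceI) (simp add: prob_density_def emeasure_density)

lemma prob_density_integrable:
  assumes "prob_density f"
  shows "integrable lborel f"
proof -
  have "has_bochner_integral lborel f 1"
    using assms by (intro has_bochner_integral_nn_integral) (auto simp: prob_density_def)
  then show ?thesis by (auto simp: has_bochner_integral_iff)
qed

text \<open>Pulling the shift out of the product exhibits the sample law as the image of a fixed measure
  under a map that is jointly measurable in parameter and sample. That is how the family
  becomes a measurable kernel.\<close>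

lemma sample_law_shift:
  assumes "prob_density f"
  shows "sample_law f \<theta> n
    = distr (sample_law f 0 n) (PiM {..<n} (\<lambda>_. borel)) (compose {..<n} ((+) \<theta>))"
proof -
  have [measurable]: "f \<in> borel_measurable borel" using assms by (simp add: prob_density_def)
  define \<mu> where "\<mu> = density lborel (\<lambda>x. ennreal (f x))"
  interpret \<mu>: prob_space \<mu> unfolding \<mu>_def by (rule prob_space_density_lborel[OF assms])
  have [simp, measurable_cong]: "sets \<mu> = sets borel" by (simp add: \<mu>_def)
  have one: "distr \<mu> \<mu> ((+) \<theta>) = density lborel (\<lambda>x. ennreal (f (x - \<theta>)))"
  proof -
    have "density lborel (\<lambda>x. ennreal (f (x - \<theta>)))
        = density (distr lborel borel ((+) \<theta>)) (\<lambda>x. ennreal (f (x - \<theta>)))"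
      by (simp add: lborel_distr_plus)
    also have "\<dots> = distr (density lborel (\<lambda>x. ennreal (f (\<theta> + x - \<theta>)))) borel ((+) \<theta>)"
      by (rule density_distr) measurable
    also have "\<dots> = distr \<mu> \<mu> ((+) \<theta>)" by (intro distr_cong) (auto simp: \<mu>_def)
    finally show ?thesis ..
  qed
  have "distr (PiM {..<n} (\<lambda>_. \<mu>)) (PiM {..<n} (\<lambda>_. \<mu>)) (compose {..<n} ((+) \<theta>))
      = PiM {..<n} (\<lambda>_. distr \<mu> \<mu> ((+) \<theta>))"
    by (rule distr_PiM_finite_prob_space') (auto simp: \<mu>.prob_space_axioms)
  also have "\<dots> = sample_law f \<theta> n" unfolding one sample_law_def ..
  finally have *: "sample_law f \<theta> n
      = distr (PiM {..<n} (\<lambda>_. \<mu>)) (PiM {..<n} (\<lambda>_. \<mu>)) (compose {..<n} ((+) \<theta>))" ..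
  show ?thesis unfolding *
    by (intro distr_cong) (auto simp: sample_law_def \<mu>_def intro!: sets_PiM_cong)
qed

lemma sets_sample_law [measurable_cong]:
  "sets (sample_law f \<theta> n) = sets (PiM {..<n} (\<lambda>_. borel))"
  by (auto simp: sample_law_def intro!: sets_PiM_cong)

lemma space_sample_law: "space (sample_law f \<theta> n) = space (PiM {..<n} (\<lambda>_. borel))"
  by (rule sets_eq_imp_space_eq[OF sets_sample_law])

lemma prob_space_sample_law:
  assumes "prob_density f" shows "prob_space (sample_law f \<theta> n)"
proof -
  have "prob_space (sample_law f 0 n)"
    unfolding sample_law_def using prob_space_density_lborel[OF assms] by (auto intro!: prob_space_PiM)
  then show ?thesis
    unfolding sample_law_shift[OF assms, of \<theta>]
    by (rule prob_space.prob_space_distr) (unfold compose_def[abs_def], measurable)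
qed

lemma sample_law_kernel [measurable]:
  assumes "prob_density f"
  shows "(\<lambda>\<theta>. sample_law f \<theta> n) \<in> borel \<rightarrow>\<^sub>M subprob_algebra (PiM {..<n} (\<lambda>_. borel))"
proof (subst sample_law_shift[OF assms], rule measurable_distr2)
  show "(\<lambda>(\<theta>, x). compose {..<n} ((+) \<theta>) x)
      \<in> borel \<Otimes>\<^sub>M PiM {..<n} (\<lambda>_. borel) \<rightarrow>\<^sub>M PiM {..<n} (\<lambda>_. borel :: real measure)"
    unfolding compose_def by measurable
  show "(\<lambda>\<theta>. sample_law f 0 n) \<in> borel \<rightarrow>\<^sub>M subprob_algebra (PiM {..<n} (\<lambda>_. borel))"
    using prob_space_sample_law[OF assms, of 0 n]
    by (intro measurable_const)
       (auto simp: space_subprob_algebra sets_sample_law prob_space_imp_subprob_space)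
qed

definition joint_kernel :: "(real \<Rightarrow> real) \<Rightarrow> nat \<Rightarrow> real \<Rightarrow> (real \<times> (nat \<Rightarrow> real)) measure" where
  "joint_kernel f n \<theta> = distr (sample_law f \<theta> n) (borel \<Otimes>\<^sub>M PiM {..<n} (\<lambda>_. borel)) (Pair \<theta>)"

lemma joint_law_eq:
  "joint_law f g n = density lborel (\<lambda>\<theta>. ennreal (g \<theta>)) \<bind> joint_kernel f n"
proof -
  have "space (sample_law f \<theta> n) \<noteq> {}" for \<theta>
    by (auto simp: space_sample_law space_PiM PiE_eq_empty_iff)
  then have "sample_law f \<theta> n \<bind> (\<lambda>x. return (borel \<Otimes>\<^sub>M PiM {..<n} (\<lambda>_. borel)) (\<theta>, x))
      = joint_kernel f n \<theta>" for \<theta>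
    unfolding joint_kernel_def
    by (intro bind_return_distr') auto
  then show ?thesis by (simp add: joint_law_def)
qed

lemma joint_kernel_measurable:
  assumes "prob_density f"
  shows "joint_kernel f n \<in> borel \<rightarrow>\<^sub>M subprob_algebra (borel \<Otimes>\<^sub>M PiM {..<n} (\<lambda>_. borel))"
  unfolding joint_kernel_def[abs_def]
  by (rule measurable_distr2[OF _ sample_law_kernel[OF assms]]) simp

lemma
  assumes "prob_density f" "prob_density g"
  shows sets_joint_law: "sets (joint_law f g n) = sets (borel \<Otimes>\<^sub>M PiM {..<n} (\<lambda>_. borel))"
    and prob_space_joint_law: "prob_space (joint_law f g n)"
proof -
  interpret G: prob_space "density lborel (\<lambda>\<theta>. ennreal (g \<theta>))"
    by (rule prob_space_density_lborel[OF assms(2)])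
  have K: "joint_kernel f n \<in> density lborel (\<lambda>\<theta>. ennreal (g \<theta>)) \<rightarrow>\<^sub>M
      subprob_algebra (borel \<Otimes>\<^sub>M PiM {..<n} (\<lambda>_. borel))"
    using joint_kernel_measurable[OF assms(1)] by simp
  show "sets (joint_law f g n) = sets (borel \<Otimes>\<^sub>M PiM {..<n} (\<lambda>_. borel))"
    unfolding joint_law_eq by (rule sets_bind[OF sets_kernel[OF K]]) auto
  show "prob_space (joint_law f g n)"
    unfolding joint_law_eq
  proof (rule G.prob_space_bind[OF _ K], rule AE_I2)
    fix \<theta>
    show "prob_space (joint_kernel f n \<theta>)"
      unfolding joint_kernel_def
      by (rule prob_space.prob_space_distr[OF prob_space_sample_law[OF assms(1)]]) measurable
  qed
qed

lemma joint_law_prob: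
  assumes "prob_density f" "prob_density g"
    and P: "Measurable.pred (borel \<Otimes>\<^sub>M PiM {..<n} (\<lambda>_. borel)) (\<lambda>(\<theta>, x). P \<theta> x)"
  shows "\<P>((\<theta>, x) in joint_law f g n. P \<theta> x)
    = (LBINT \<theta>. g \<theta> * \<P>(x in sample_law f \<theta> n. P \<theta> x))"
proof -
  interpret G: prob_space "density lborel (\<lambda>\<theta>. ennreal (g \<theta>))"
    by (rule prob_space_density_lborel[OF assms(2)])
  have K: "joint_kernel f n \<in> density lborel (\<lambda>\<theta>. ennreal (g \<theta>)) \<rightarrow>\<^sub>M
      subprob_algebra (borel \<Otimes>\<^sub>M PiM {..<n} (\<lambda>_. borel))"
    using joint_kernel_measurable[OF assms(1)] by simp
  have g[measurable]: "g \<in> borel_measurable borel" "\<And>\<theta>. 0 \<le> g \<theta>"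
    using assms(2) by (auto simp: prob_density_def)
  define X where "X = {\<omega> \<in> space (borel \<Otimes>\<^sub>M PiM {..<n} (\<lambda>_. borel)). case \<omega> of (\<theta>, x) \<Rightarrow> P \<theta> x}"
  have X: "X \<in> sets (borel \<Otimes>\<^sub>M PiM {..<n} (\<lambda>_. borel))"
    using P unfolding X_def pred_def .
  have "\<P>((\<theta>, x) in joint_law f g n. P \<theta> x) = measure (joint_law f g n) X"
    unfolding X_def sets_eq_imp_space_eq[OF sets_joint_law[OF assms(1,2)]]
    by (rule arg_cong[where f = "measure (joint_law f g n)"]) auto
  also have "\<dots> = (\<integral>\<theta>. measure (joint_kernel f n \<theta>) X \<partial>density lborel (\<lambda>\<theta>. ennreal (g \<theta>)))"
    unfolding joint_law_eq by (rule G.measure_bind[OF K X])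
  also have "\<dots> = (LBINT \<theta>. g \<theta> * measure (joint_kernel f n \<theta>) X)"
  proof (subst integral_density)
    show "(\<lambda>\<theta>. measure (joint_kernel f n \<theta>) X) \<in> borel_measurable lborel"
      using measurable_compose[OF joint_kernel_measurable[OF assms(1)] measurable_measure_subprob_algebra[OF X]]
      by simp
  qed (use g in auto)
  also have "\<dots> = (LBINT \<theta>. g \<theta> * \<P>(x in sample_law f \<theta> n. P \<theta> x))"
  proof -
    have "measure (joint_kernel f n \<theta>) X = \<P>(x in sample_law f \<theta> n. P \<theta> x)" for \<theta>
      unfolding joint_kernel_def
      by (subst measure_distr[OF _ X])
         (auto simp: X_def space_pair_measure space_sample_law intro!: arg_cong[where f="measure _"])
    then show ?thesis by simp
  qed
  finally show ?thesis .
qed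

lemma sample_law_prob_measurable:
  assumes "prob_density f"
    and P: "Measurable.pred (borel \<Otimes>\<^sub>M PiM {..<n} (\<lambda>_. borel)) (\<lambda>(\<theta>, x). P \<theta> x)"
  shows "(\<lambda>\<theta>. \<P>(x in sample_law f \<theta> n. P \<theta> x)) \<in> borel_measurable borel"
proof (rule measure_measurable_subprob_algebra2[OF _ sample_law_kernel[OF assms(1)]])
  have "(SIGMA \<theta>:space borel. {x \<in> space (sample_law f \<theta> n). P \<theta> x})
      = {\<omega> \<in> space (borel \<Otimes>\<^sub>M PiM {..<n} (\<lambda>_. borel)). case \<omega> of (\<theta>, x) \<Rightarrow> P \<theta> x}"
    by (auto simp: space_pair_measure space_sample_law)
  then show "(SIGMA \<theta>:space borel. {x \<in> space (sample_law f \<theta> n). P \<theta> x})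
      \<in> sets (borel \<Otimes>\<^sub>M PiM {..<n} (\<lambda>_. borel))"
    using P by (simp add: pred_def)
qed

lemma joint_measurable_median:
  assumes "n \<ge> 1"
  shows "(\<lambda>\<omega>. sample_median n (snd \<omega>)) \<in> borel_measurable (borel \<Otimes>\<^sub>M PiM {..<n} (\<lambda>_. borel))"
  by (rule measurable_compose[OF measurable_snd sample_median_measurable[OF assms]])

lemma test_event_iff:
  fixes f0 :: real
  assumes "f0 > 0"
  shows "sqrt (real n) * m \<le> z / (2 * f0)
    \<longleftrightarrow> 2 * f0 * sqrt (real n) * (m - \<theta>) \<le> z - 2 * f0 * sqrt (real n) * \<theta>"
  using assms by (simp add: field_simps)

definition accept_prob :: "(real \<Rightarrow> real) \<Rightarrow> real \<Rightarrow> nat \<Rightarrow> real \<Rightarrow> real" where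
  "accept_prob f \<alpha> n \<theta> = \<P>(x in sample_law f \<theta> n. sqrt (real n) * sample_median n x \<le> crit f \<alpha>)"

lemma accept_prob_eq:
  assumes "f 0 > 0"
  shows "accept_prob f \<alpha> n \<theta> = median_cdf f \<theta> n (z_quantile \<alpha> - 2 * f 0 * sqrt (real n) * \<theta>)"
  unfolding accept_prob_def median_cdf_def crit_def test_event_iff[OF assms, of _ _ _ \<theta>] ..

lemma accept_prob_measurable:
  assumes "prob_density f" "n \<ge> 1"
  shows "accept_prob f \<alpha> n \<in> borel_measurable borel"
proof -
  note [measurable] = joint_measurable_median[OF assms(2)]
  show ?thesis
    unfolding accept_prob_def[abs_def]
    by (rule sample_law_prob_measurable[OF assms(1)]) (simp add: case_prod_unfold)
qed

lemma accept_prob_bounds: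
  assumes "prob_density f"
  shows "0 \<le> accept_prob f \<alpha> n \<theta>" "accept_prob f \<alpha> n \<theta> \<le> 1"
  unfolding accept_prob_def
  using prob_space.prob_le_1[OF prob_space_sample_law[OF assms]] by auto

lemma
  assumes "prob_density f" "prob_density g" "n \<ge> 1"
  shows err_A_eq: "err_A f g \<alpha> n
      = (LBINT u. indicator {0<..} u * (g (- u) * (1 - accept_prob f \<alpha> n (- u))))"
    and err_At_eq: "err_At f g \<alpha> n
      = (LBINT u. indicator {0<..} u * (g u * accept_prob f \<alpha> n u))"
proof -
  note [measurable] = joint_measurable_median[OF assms(3)] sample_median_measurable[OF assms(3)]
    accept_prob_measurable[OF assms(1,3)]
  have g[measurable]: "g \<in> borel_measurable borel"
    using assms(2) by (auto simp: prob_density_def)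
  have "err_A f g \<alpha> n = (LBINT \<theta>. g \<theta> * \<P>(x in sample_law f \<theta> n.
      \<theta> \<le> 0 \<and> sqrt (real n) * sample_median n x > crit f \<alpha>))"
    unfolding err_A_def by (rule joint_law_prob[OF assms(1,2)]) (simp add: case_prod_unfold)
  also have "\<dots> = (LBINT \<theta>. indicator {..0} \<theta> * (g \<theta> * (1 - accept_prob f \<alpha> n \<theta>)))"
  proof (rule Bochner_Integration.integral_cong[OF refl])
    fix \<theta> :: real
    interpret S: prob_space "sample_law f \<theta> n" by (rule prob_space_sample_law[OF assms(1)])
    have "{x \<in> space (sample_law f \<theta> n). sqrt (real n) * sample_median n x \<le> crit f \<alpha>} \<in> S.events"
      by measurable
    from S.prob_neg[OF this]
    have "\<P>(x in sample_law f \<theta> n. sqrt (real n) * sample_median n x > crit f \<alpha>) = 1 - accept_prob f \<alpha> n \<theta>"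
      by (simp add: accept_prob_def not_le)
    then show "g \<theta> * \<P>(x in sample_law f \<theta> n. \<theta> \<le> 0 \<and> sqrt (real n) * sample_median n x > crit f \<alpha>)
        = indicator {..0} \<theta> * (g \<theta> * (1 - accept_prob f \<alpha> n \<theta>))"
      by (cases "\<theta> \<le> 0") auto
  qed
  also have "\<dots> = (LBINT u. indicator {..0} (- u) * (g (- u) * (1 - accept_prob f \<alpha> n (- u))))"
    using lborel_integral_real_affine[of "- 1" "\<lambda>\<theta>. indicator {..0} \<theta> * (g \<theta> * (1 - accept_prob f \<alpha> n \<theta>))" 0]
    by simp
  also have "\<dots> = (LBINT u. indicator {0<..} u * (g (- u) * (1 - accept_prob f \<alpha> n (- u))))"
  \<comment> \<open>the two half-lines differ by the null set \<open>{0}\<close>\<close>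
  proof (rule integral_cong_AE)
    show "AE u in lborel. indicator {..0} (- u) * (g (- u) * (1 - accept_prob f \<alpha> n (- u)))
        = indicator {0<..} u * (g (- u) * (1 - accept_prob f \<alpha> n (- u)))"
      using AE_lborel_singleton[of "0::real"] by eventually_elim (auto simp: indicator_def)
  qed measurable
  finally show "err_A f g \<alpha> n
      = (LBINT u. indicator {0<..} u * (g (- u) * (1 - accept_prob f \<alpha> n (- u))))" .
  have "err_At f g \<alpha> n = (LBINT \<theta>. g \<theta> * \<P>(x in sample_law f \<theta> n.
      \<theta> > 0 \<and> sqrt (real n) * sample_median n x \<le> crit f \<alpha>))"
    unfolding err_At_def by (rule joint_law_prob[OF assms(1,2)]) (simp add: case_prod_unfold)
  also have "\<dots> = (LBINT u. indicator {0<..} u * (g u * accept_prob f \<alpha> n u))"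
  proof (rule Bochner_Integration.integral_cong[OF refl])
    fix \<theta> :: real
    show "g \<theta> * \<P>(x in sample_law f \<theta> n. \<theta> > 0 \<and> sqrt (real n) * sample_median n x \<le> crit f \<alpha>)
        = indicator {0<..} \<theta> * (g \<theta> * accept_prob f \<alpha> n \<theta>)"
      by (cases "\<theta> > 0") (auto simp: accept_prob_def)
  qed
  finally show "err_At f g \<alpha> n = (LBINT u. indicator {0<..} u * (g u * accept_prob f \<alpha> n u))" .
qed

lemma
  assumes "prob_density f" "prob_density g" "n \<ge> 1"
  shows err_delta_eq: "err_delta f g \<alpha> n
      = err_A f g \<alpha> n / (prior_alt g - (err_At f g \<alpha> n - err_A f g \<alpha> n))"
    and err_eps_eq: "err_eps f g \<alpha> n
      = err_At f g \<alpha> n / (1 - prior_alt g + (err_At f g \<alpha> n - err_A f g \<alpha> n))"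
proof -
  note [measurable] = joint_measurable_median[OF assms(3)]
  note [measurable_cong] = sets_joint_law[OF assms(1,2)]
  interpret J: prob_space "joint_law f g n" by (rule prob_space_joint_law[OF assms(1,2)])
  let ?T = "\<lambda>x. sqrt (real n) * sample_median n x"
  have alt: "\<P>((\<theta>, x) in joint_law f g n. \<theta> > 0) = prior_alt g"
  proof -
    have "\<P>((\<theta>, x) in joint_law f g n. \<theta> > 0)
        = (LBINT \<theta>. g \<theta> * \<P>(x in sample_law f \<theta> n. \<theta> > 0))"
      by (rule joint_law_prob[OF assms(1,2)]) (simp add: case_prod_unfold)
    also have "\<dots> = prior_alt g"
      unfolding prior_alt_def set_lebesgue_integral_def
    proof (rule Bochner_Integration.integral_cong[OF refl])
      fix \<theta> :: real
      interpret S: prob_space "sample_law f \<theta> n" by (rule prob_space_sample_law[OF assms(1)])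
      show "g \<theta> * \<P>(x in sample_law f \<theta> n. \<theta> > 0) = indicator {0<..} \<theta> *\<^sub>R g \<theta>"
        by (cases "\<theta> > 0") (auto simp: S.prob_space)
    qed
    finally show ?thesis .
  qed
  have split: "\<P>(\<omega> in joint_law f g n. P \<omega>)
      = \<P>(\<omega> in joint_law f g n. P \<omega> \<and> Q \<omega>) + \<P>(\<omega> in joint_law f g n. P \<omega> \<and> \<not> Q \<omega>)"
    if [measurable]: "Measurable.pred (joint_law f g n) P" "Measurable.pred (joint_law f g n) Q" for P Q
  proof -
    have "{\<omega> \<in> space (joint_law f g n). P \<omega>} = {\<omega> \<in> space (joint_law f g n). P \<omega> \<and> Q \<omega>}
        \<union> {\<omega> \<in> space (joint_law f g n). P \<omega> \<and> \<not> Q \<omega>}" by auto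
    then show ?thesis by (simp only:, intro J.finite_measure_Union) (measurable, auto)
  qed
  have m: "Measurable.pred (joint_law f g n) (\<lambda>(\<theta>, x). \<theta> > 0)"
    "Measurable.pred (joint_law f g n) (\<lambda>(\<theta>, x). ?T x \<le> crit f \<alpha>)"
    "Measurable.pred (joint_law f g n) (\<lambda>(\<theta>, x). ?T x > crit f \<alpha>)"
    unfolding case_prod_unfold by measurable
  have rej: "\<P>((\<theta>, x) in joint_law f g n. ?T x > crit f \<alpha>)
      = prior_alt g - (err_At f g \<alpha> n - err_A f g \<alpha> n)"
    using split[OF m(3,1)] split[OF m(1,2)] alt
    by (simp add: err_A_def err_At_def case_prod_unfold not_less not_le conj_commute)
  have acc: "\<P>((\<theta>, x) in joint_law f g n. ?T x \<le> crit f \<alpha>)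
      = 1 - prior_alt g + (err_At f g \<alpha> n - err_A f g \<alpha> n)"
  proof -
    have "{\<omega> \<in> space (joint_law f g n). case \<omega> of (\<theta>, x) \<Rightarrow> ?T x > crit f \<alpha>} \<in> J.events"
      unfolding case_prod_unfold by measurable
    from J.prob_neg[OF this] rej show ?thesis by (simp add: case_prod_unfold not_less)
  qed
  have "err_delta f g \<alpha> n = err_A f g \<alpha> n / \<P>((\<theta>, x) in joint_law f g n. ?T x > crit f \<alpha>)"
    unfolding err_delta_def cond_prob_def err_A_def by (simp add: case_prod_unfold)
  then show "err_delta f g \<alpha> n = err_A f g \<alpha> n / (prior_alt g - (err_At f g \<alpha> n - err_A f g \<alpha> n))"
    by (simp only: rej)
  have "err_eps f g \<alpha> n = err_At f g \<alpha> n / \<P>((\<theta>, x) in joint_law f g n. ?T x \<le> crit f \<alpha>)"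
    unfolding err_eps_def cond_prob_def err_At_def by (simp add: case_prod_unfold)
  then show "err_eps f g \<alpha> n = err_At f g \<alpha> n / (1 - prior_alt g + (err_At f g \<alpha> n - err_A f g \<alpha> n))"
    by (simp only: acc)
qed

section \<open>Quotients of expansions\<close>

text \<open>The coefficients solve the triangular system obtained from \<open>A = (l - W) * S\<close> by comparing powers
  of \<open>e\<close>. With them \<open>A - (l - W) * S\<close> is of fourth order, and dividing by \<open>l - W\<close>, which tends
  to \<open>l \<noteq> 0\<close>, preserves this. The coefficients may depend on \<open>n\<close>, as long as they
  are bounded.\<close>

lemma ratio_expansion:
  fixes A W a2 a3 b2 b3 e :: "nat \<Rightarrow> real" and a1 b1 l :: real
  assumes A: "(\<lambda>n. A n - (a1 * e n + a2 n * (e n)\<^sup>2 + a3 n * e n ^ 3)) \<in> O(\<lambda>n. e n ^ 4)"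
    and W: "(\<lambda>n. W n - (b1 * e n + b2 n * (e n)\<^sup>2 + b3 n * e n ^ 3)) \<in> O(\<lambda>n. e n ^ 4)"
    and bounded [intro]: "a2 \<in> O(\<lambda>_. 1)" "a3 \<in> O(\<lambda>_. 1)" "b2 \<in> O(\<lambda>_. 1)" "b3 \<in> O(\<lambda>_. 1)"
    and e: "e \<longlonglongrightarrow> 0" and l: "l \<noteq> 0"
  shows "(\<lambda>n. A n / (l - W n) - (a1 / l * e n + (a1 * b1 / l\<^sup>2 + a2 n / l) * (e n)\<^sup>2
      + (a3 n / l + (a1 * b2 n + a2 n * b1) / l\<^sup>2 + a1 * b1\<^sup>2 / l ^ 3) * e n ^ 3)) \<in> O(\<lambda>n. e n ^ 4)"
proof -
  define c1 where "c1 = a1 / l"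
  define c2 where "c2 = (\<lambda>n. a1 * b1 / l\<^sup>2 + a2 n / l)"
  define c3 where "c3 = (\<lambda>n. a3 n / l + (a1 * b2 n + a2 n * b1) / l\<^sup>2 + a1 * b1\<^sup>2 / l ^ 3)"
  define S where "S = (\<lambda>n. c1 * e n + c2 n * (e n)\<^sup>2 + c3 n * e n ^ 3)"
  define V where "V = (\<lambda>n. b1 * e n + b2 n * (e n)\<^sup>2 + b3 n * e n ^ 3)"
  define U where "U = (\<lambda>n. a1 * e n + a2 n * (e n)\<^sup>2 + a3 n * e n ^ 3)"
  have e_small: "e \<in> o(\<lambda>_. 1)" using e by (intro smalloI_tendsto) auto
  have e1 [intro]: "e \<in> O(\<lambda>_. 1)" by (rule landau_o.small_imp_big[OF e_small])
  have const [intro]: "(\<lambda>_. c) \<in> O(\<lambda>_::nat. 1::real)" for c by simp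
  note O1 = sum_in_bigo(1) landau_o.big.mult_in_1
  have pow [intro]: "(\<lambda>n. e n ^ k) \<in> O(\<lambda>_. 1)" for k
    by (induction k) (auto intro!: landau_o.big.mult_in_1)
  have c2O: "c2 \<in> O(\<lambda>_. 1)" unfolding c2_def divide_inverse by (intro O1 bounded const)
  have c3O: "c3 \<in> O(\<lambda>_. 1)" unfolding c3_def divide_inverse by (intro O1 bounded const)
  have S: "S \<in> O(\<lambda>_. 1)" unfolding S_def by (intro O1 c2O c3O const pow e1)
  have "V \<in> O(e)"
  proof -
    have "V = (\<lambda>n. e n * (b1 + b2 n * e n + b3 n * (e n)\<^sup>2))"
      by (auto simp: V_def power2_eq_square power3_eq_cube algebra_simps)
    also have "\<dots> \<in> O(\<lambda>n. e n * 1)"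
      by (intro landau_o.big.mult O1 bounded const pow e1) simp
    finally show ?thesis by simp
  qed
  moreover have "(\<lambda>n. e n ^ 4) \<in> O(e)"
  proof -
    have "(\<lambda>n. e n * e n ^ 3) \<in> O(\<lambda>n. e n * 1)" by (intro landau_o.big.mult pow) simp
    then show ?thesis by (simp add: eval_nat_numeral)
  qed
  ultimately have "(\<lambda>n. W n - V n + V n) \<in> O(e)"
    using landau_o.big_trans[OF W] by (intro sum_in_bigo(1)) (simp_all only: V_def)
  then have "W \<in> o(\<lambda>_. 1)" using e_small by (simp add: landau_o.big_small_trans)
  then have "W \<longlonglongrightarrow> 0" using smalloD_tendsto by fastforce
  then have lim: "(\<lambda>n. l - W n) \<longlonglongrightarrow> l" by (auto intro!: tendsto_eq_intros)
  have nz: "\<forall>\<^sub>F n in sequentially. l - W n \<noteq> 0"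
    using tendsto_imp_eventually_ne[OF lim l] .
  have inv: "(\<lambda>n. 1 / (l - W n)) \<in> O(\<lambda>_. 1)"
    using lim l by (intro bigoI_tendsto[where c = "1 / l"]) (auto intro!: tendsto_intros)
  \<comment> \<open>the choice of the coefficients kills the orders one to three\<close>
  have cancel: "U n - (l - V n) * S n = e n ^ 4 * (b1 * c3 n + b2 n * c2 n + b3 n * c1
      + e n * (b2 n * c3 n + b3 n * c2 n) + (e n)\<^sup>2 * (b3 n * c3 n))" for n
  proof -
    have *: "l * c1 = a1" "l * c2 n = a2 n + b1 * c1" "l * c3 n = a3 n + b1 * c2 n + b2 n * c1"
      using l by (auto simp: c1_def c2_def c3_def field_simps power2_eq_square power3_eq_cube)
    have "U n - (l - V n) * S n = (a1 - l * c1) * e n + (a2 n + b1 * c1 - l * c2 n) * (e n)\<^sup>2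
        + (a3 n + b1 * c2 n + b2 n * c1 - l * c3 n) * e n ^ 3
        + e n ^ 4 * (b1 * c3 n + b2 n * c2 n + b3 n * c1
      + e n * (b2 n * c3 n + b3 n * c2 n) + (e n)\<^sup>2 * (b3 n * c3 n))"
      unfolding U_def V_def S_def by (simp add: eval_nat_numeral algebra_simps)
    then show ?thesis unfolding * by simp
  qed
  have "(\<lambda>n. (A n - U n) + (W n - V n) * S n + (U n - (l - V n) * S n)) \<in> O(\<lambda>n. e n ^ 4)"
  proof (intro sum_in_bigo(1))
    show "(\<lambda>n. A n - U n) \<in> O(\<lambda>n. e n ^ 4)" using A by (simp add: U_def)
    have "(\<lambda>n. (W n - V n) * S n) \<in> O(\<lambda>n. e n ^ 4 * 1)"
      using W S by (intro landau_o.big.mult) (auto simp: V_def)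
    then show "(\<lambda>n. (W n - V n) * S n) \<in> O(\<lambda>n. e n ^ 4)" by simp
    have "(\<lambda>n. U n - (l - V n) * S n) \<in> O(\<lambda>n. e n ^ 4 * 1)"
      unfolding cancel by (intro landau_o.big.mult O1 bounded const pow e1 c2O c3O) simp
    then show "(\<lambda>n. U n - (l - V n) * S n) \<in> O(\<lambda>n. e n ^ 4)" by simp
  qed
  from landau_o.big.mult[OF this inv]
  have "(\<lambda>n. (A n - (l - W n) * S n) * (1 / (l - W n))) \<in> O(\<lambda>n. e n ^ 4)"
    by (simp add: algebra_simps)
  also have "?this \<longleftrightarrow> (\<lambda>n. A n / (l - W n) - S n) \<in> O(\<lambda>n. e n ^ 4)"
    by (rule landau_o.big.in_cong, use nz in eventually_elim) (simp add: field_simps)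
  finally show ?thesis unfolding S_def c1_def c2_def c3_def .
qed

section \<open>Expansion of the error probabilities\<close>

text \<open>Only the third derivative is assumed bounded; the prior itself is controlled by this cubic
  inequality, which the normal density makes integrable.\<close>

lemma prior_taylor:
  assumes "\<And>k x. k < 3 \<Longrightarrow> (deriv ^^ k) g field_differentiable at x"
    and "bounded (range ((deriv ^^ 3) g))"
  shows "\<exists>M\<ge>0. \<forall>v::real. \<bar>g v - (g 0 + deriv g 0 * v + deriv (deriv g) 0 / 2 * v\<^sup>2)\<bar> \<le> M * \<bar>v\<bar> ^ 3"
proof -
  obtain M where M: "\<And>x. \<bar>(deriv ^^ 3) g x\<bar> \<le> M"
    using assms(2) by (auto simp: bounded_iff)
  show ?thesis
  proof (intro exI[of _ "M / 6"] conjI allI)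
    show "0 \<le> M / 6" using M[of 0] by linarith
    fix v :: real
    have "\<forall>m t. m < 3 \<and> \<bar>t\<bar> \<le> \<bar>v\<bar> \<longrightarrow> ((deriv ^^ m) g has_real_derivative (deriv ^^ Suc m) g t) (at t)"
      using assms(1) by (auto simp: DERIV_deriv_iff_field_differentiable)
    from Maclaurin_bi_le[OF _ this, of g] obtain t
      where t: "g v = (\<Sum>m<3. (deriv ^^ m) g 0 / fact m * v ^ m) + (deriv ^^ 3) g t / fact 3 * v ^ 3"
      by auto
    have "(\<Sum>m<3. (deriv ^^ m) g 0 / fact m * v ^ m) = g 0 + deriv g 0 * v + deriv (deriv g) 0 / 2 * v\<^sup>2"
      by (simp add: eval_nat_numeral)
    with t have "g v - (g 0 + deriv g 0 * v + deriv (deriv g) 0 / 2 * v\<^sup>2) = (deriv ^^ 3) g t / 6 * v ^ 3"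
      by (simp add: fact_numeral)
    also have "\<bar>\<dots>\<bar> \<le> M / 6 * \<bar>v\<bar> ^ 3"
      using M[of t] by (simp add: abs_mult power_abs mult_right_mono)
    finally show "\<bar>g v - (g 0 + deriv g 0 * v + deriv (deriv g) 0 / 2 * v\<^sup>2)\<bar> \<le> M / 6 * \<bar>v\<bar> ^ 3" .
  qed
qed

lemma poly_growth:
  fixes p :: "real poly"
  assumes "degree p \<le> d" "\<And>i. \<bar>coeff p i\<bar> \<le> K"
  shows "\<bar>poly p t\<bar> \<le> (real d + 1) * K * (1 + \<bar>t\<bar>) ^ d"
proof -
  have K: "0 \<le> K" using assms(2)[of 0] by linarith
  have "\<bar>poly p t\<bar> \<le> (\<Sum>i\<le>degree p. \<bar>coeff p i * t ^ i\<bar>)"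
    unfolding poly_altdef by (rule sum_abs)
  also have "\<dots> \<le> (\<Sum>i\<le>degree p. K * (1 + \<bar>t\<bar>) ^ d)"
  proof (rule sum_mono)
    fix i assume "i \<in> {..degree p}"
    then have "i \<le> d" using assms(1) by simp
    have "\<bar>t\<bar> ^ i \<le> (1 + \<bar>t\<bar>) ^ i" by (intro power_mono) auto
    also have "\<dots> \<le> (1 + \<bar>t\<bar>) ^ d" using \<open>i \<le> d\<close> by (intro power_increasing) auto
    finally show "\<bar>coeff p i * t ^ i\<bar> \<le> K * (1 + \<bar>t\<bar>) ^ d"
      using assms(2)[of i] K by (auto simp: abs_mult power_abs intro!: mult_mono)
  qed
  also have "\<dots> = (real (degree p) + 1) * (K * (1 + \<bar>t\<bar>) ^ d)" by simp
  also have "\<dots> \<le> (real d + 1) * (K * (1 + \<bar>t\<bar>) ^ d)"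
    using assms(1) K by (intro mult_right_mono) auto
  finally show ?thesis by (simp add: mult_ac)
qed

lemma parity_coeff_bounds:
  "\<bar>f12 n\<bar> \<le> 1" "\<bar>f23 n\<bar> \<le> 1"
  "\<bar>f22 f n\<bar> \<le> 1 + \<bar>deriv f 0 / (2 * (f 0)\<^sup>2)\<bar> + \<bar>deriv (deriv f) 0 / (24 * (f 0) ^ 3)\<bar>"
proof -
  have r: "0 \<le> frac (real n / 2)" "frac (real n / 2) < 1" by (auto simp: frac_lt_1)
  then have q: "\<bar>1 - 2 * frac (real n / 2)\<bar> \<le> 1" by linarith
  then show "\<bar>f12 n\<bar> \<le> 1" by (simp add: f12_def)
  have "(1 - 2 * frac (real n / 2))\<^sup>2 \<le> 1" using q by (simp add: abs_square_le_1)
  moreover have "0 \<le> (1 - 2 * frac (real n / 2))\<^sup>2" by simp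
  ultimately show "\<bar>f23 n\<bar> \<le> 1" unfolding f23_def by linarith
  have "\<bar>1 / 2 - frac (real n / 2)\<bar> \<le> 1" using r by linarith
  then have "\<bar>(1 / 2 - frac (real n / 2)) * (deriv f 0 / (2 * (f 0)\<^sup>2))\<bar> \<le> 1 * \<bar>deriv f 0 / (2 * (f 0)\<^sup>2)\<bar>"
    unfolding abs_mult by (rule mult_right_mono) simp
  then show "\<bar>f22 f n\<bar> \<le> 1 + \<bar>deriv f 0 / (2 * (f 0)\<^sup>2)\<bar> + \<bar>deriv (deriv f) 0 / (24 * (f 0) ^ 3)\<bar>"
    unfolding f22_def by linarith
qed

lemma parity_coeffs_bigo:
  "f12 \<in> O(\<lambda>_. 1)" "f23 \<in> O(\<lambda>_. 1)" "f22 f \<in> O(\<lambda>_. 1)"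
proof -
  show "f12 \<in> O(\<lambda>_. 1)" "f23 \<in> O(\<lambda>_. 1)"
    by (rule bigoI[where c = 1], simp add: parity_coeff_bounds)+
  show "f22 f \<in> O(\<lambda>_. 1)"
    by (rule bigoI[where c = "1 + \<bar>deriv f 0 / (2 * (f 0)\<^sup>2)\<bar> + \<bar>deriv (deriv f) 0 / (24 * (f 0) ^ 3)\<bar>"])
       (intro always_eventually allI, simp only: abs_one mult_1_right real_norm_def parity_coeff_bounds)
qed

lemma b_eq_at_minus_a:
  shows "b1 f g \<alpha> = at1 f g \<alpha> - a1 f g \<alpha>" "b2 f g \<alpha> n = at2 f g \<alpha> n - a2 f g \<alpha> n"
    "b3 f g \<alpha> n = at3 f g \<alpha> n - a3 f g \<alpha> n"
  by (simp_all add: b1_def b2_def b3_def at1_def at2_def at3_def a1_def a2_def a3_def Let_def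
      ring_distribs add_divide_distrib diff_divide_distrib mult_ac)

lemma err_expansions:
  fixes f g :: "real \<Rightarrow> real" and \<alpha> :: real
  assumes f: "prob_density f" "f 0 > 0" "reiss_expansion f"
    and alpha: "0 < \<alpha>" "\<alpha> < 1"
    and g: "prob_density g" "\<And>k x. k < 3 \<Longrightarrow> (deriv ^^ k) g field_differentiable at x"
      "bounded (range ((deriv ^^ 3) g))"
  shows "(\<lambda>n. err_A f g \<alpha> n
        - (a1 f g \<alpha> / sqrt (real n) + a2 f g \<alpha> n / real n + a3 f g \<alpha> n / real n powr (3 / 2)))
       \<in> O(\<lambda>n. 1 / (real n)\<^sup>2)" (is ?A)
    and "(\<lambda>n. err_At f g \<alpha> n
        - (at1 f g \<alpha> / sqrt (real n) + at2 f g \<alpha> n / real n + at3 f g \<alpha> n / real n powr (3 / 2)))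
       \<in> O(\<lambda>n. 1 / (real n)\<^sup>2)" (is ?At)
proof -
  define z where "z = z_quantile \<alpha>"
  define \<kappa> where "\<kappa> = 2 * f 0"
  have \<kappa>: "\<kappa> > 0" using f by (simp add: \<kappa>_def)
  have Phi_z: "Phi z = 1 - \<alpha>" "Phi (- z) = \<alpha>"
    using Phi_z_quantile[OF alpha] by (auto simp: z_def Phi_minus)
  obtain M where M: "M \<ge> 0"
    "\<And>v. \<bar>g v - (g 0 + deriv g 0 * v + deriv (deriv g) 0 / 2 * v\<^sup>2)\<bar> \<le> M * \<bar>v\<bar> ^ 3"
    using prior_taylor[OF g(2,3)] by blast
  obtain R d K C where R: "\<And>n. degree (R n) \<le> d" "\<And>n i. \<bar>coeff (R n) i\<bar> \<le> K"
    and reiss: "\<forall>\<^sub>F n in sequentially. \<forall>\<theta> t.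
           \<bar>median_cdf f \<theta> n t
             - (Phi t
                + phi t / sqrt (real n) * (f11 f * t\<^sup>2 + f12 n)
                + phi t / real n * (f21 f * t ^ 5 + f22 f n * t ^ 3 + f23 n * t)
                + phi t * poly (R n) t / real n powr (3 / 2))\<bar>
           \<le> C / (real n)\<^sup>2"
    using f(3) unfolding reiss_expansion_def by blast
  define L where "L = 2 + \<bar>deriv f 0 / (2 * (f 0)\<^sup>2)\<bar> + \<bar>deriv (deriv f) 0 / (24 * (f 0) ^ 3)\<bar>
    + (real d + 1) * K"
  have K0: "0 \<le> (real d + 1) * K" using R(2)[of 0 0] by (intro mult_nonneg_nonneg) auto
  have L: "\<bar>f12 n\<bar> \<le> L" "\<bar>- f12 n\<bar> \<le> L" "\<bar>f22 f n\<bar> \<le> L" "\<bar>f23 n\<bar> \<le> L" for n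
    using parity_coeff_bounds(1,2)[of n] parity_coeff_bounds(3)[of f n] K0
    unfolding L_def by linarith+
  have pR: "\<bar>poly (R n) t\<bar> \<le> L * (1 + \<bar>t\<bar>) ^ d" for n t
    by (rule order_trans[OF poly_growth[OF R]], rule mult_right_mono) (auto simp: L_def)
  have poly_measurable: "poly p \<in> borel_measurable borel"
    and poly_measurable': "(\<lambda>t. - poly p (- t)) \<in> borel_measurable borel" for p :: "real poly"
    by (intro borel_measurable_continuous_onI continuous_intros)+
  have g_int: "integrable lborel g" and g0: "\<And>x. 0 \<le> g x"
    using prob_density_integrable[OF g(1)] g(1) by (auto simp: prob_density_def)
  have g_int': "integrable lborel (\<lambda>u. g (- u))"
    using lborel_integrable_real_affine_iff[of "- 1" g 0] g_int by simp
  note acc = accept_prob_bounds[OF f(1)]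
  have Q_A_measurable: "(\<lambda>u. 1 - accept_prob f \<alpha> n (- u)) \<in> borel_measurable borel" if "n \<ge> 1" for n
    using accept_prob_measurable[OF f(1) that, of \<alpha>] by measurable
  have ev1: "\<forall>\<^sub>F n in sequentially. err_A f g \<alpha> n
      = (LBINT u. indicator {0<..} u * (g (- u) * (1 - accept_prob f \<alpha> n (- u))))"
    using eventually_ge_at_top[of 1] by eventually_elim (rule err_A_eq[OF f(1) g(1)])
  have ev2: "\<forall>\<^sub>F n in sequentially. err_At f g \<alpha> n
      = (LBINT u. indicator {0<..} u * (g u * accept_prob f \<alpha> n u))"
    using eventually_ge_at_top[of 1] by eventually_elim (rule err_At_eq[OF f(1) g(1)])
  have "\<forall>\<^sub>F n in sequentially. \<forall>t. \<forall>u\<ge>0. t = z + \<kappa> * sqrt (real n) * u \<longrightarrow>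
      \<bar>1 - accept_prob f \<alpha> n (- u) - (Phi (- t) - phi t * ((f11 f * t\<^sup>2 + f12 n) / sqrt (real n)
          + (f21 f * t ^ 5 + f22 f n * t ^ 3 + f23 n * t) / real n
          + poly (R n) t / real n powr (3 / 2)))\<bar> \<le> C / (real n)\<^sup>2"
    using reiss
  proof eventually_elim
    case (elim n)
    show ?case
    proof (intro allI impI)
      fix t u assume t: "t = z + \<kappa> * sqrt (real n) * u"
      have acc_eq: "accept_prob f \<alpha> n (- u) = median_cdf f (- u) n t"
        unfolding accept_prob_eq[of f, OF f(2)] by (simp add: t z_def \<kappa>_def)
      have "1 - q - (Phi (- t) - phi t * ((f11 f * t\<^sup>2 + f12 n) / sqrt (real n)
          + (f21 f * t ^ 5 + f22 f n * t ^ 3 + f23 n * t) / real n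
          + poly (R n) t / real n powr (3 / 2)))
        = - (q - (Phi t
                + phi t / sqrt (real n) * (f11 f * t\<^sup>2 + f12 n)
                + phi t / real n * (f21 f * t ^ 5 + f22 f n * t ^ 3 + f23 n * t)
                + phi t * poly (R n) t / real n powr (3 / 2)))" for q
        by (simp add: Phi_minus ring_distribs add_divide_distrib mult_ac)
      with elim[rule_format, of "- u" t]
      show "\<bar>1 - accept_prob f \<alpha> n (- u) - (Phi (- t) - phi t * ((f11 f * t\<^sup>2 + f12 n) / sqrt (real n)
          + (f21 f * t ^ 5 + f22 f n * t ^ 3 + f23 n * t) / real n
          + poly (R n) t / real n powr (3 / 2)))\<bar> \<le> C / (real n)\<^sup>2"
        by (simp only: acc_eq abs_minus_cancel)
    qed
  qed
  note approx_A = this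
  have taylor_A: "\<bar>g (- v) - (g 0 + - deriv g 0 * v + deriv (deriv g) 0 / 2 * v\<^sup>2)\<bar> \<le> M * v ^ 3"
    if "v \<ge> 0" for v
    using M(2)[of "- v"] that by simp
  have Q_A: "0 \<le> 1 - accept_prob f \<alpha> n (- u)" "1 - accept_prob f \<alpha> n (- u) \<le> 1" for n u
    using acc by auto
  \<comment> \<open>the density on the half-line is \<open>g (- u)\<close>, whence the negated first derivative\<close>
  have coeffs_A: "a1 f g \<alpha> = g 0 / \<kappa> * (phi z - z * Phi (- z))"
    "a2 f g \<alpha> n = - deriv g 0 / (2 * \<kappa>\<^sup>2) * (Phi (- z) * (z\<^sup>2 + 1) - z * phi z)
       - g 0 / \<kappa> * (f11 f * (z * phi z + Phi (- z)) + f12 n * Phi (- z))"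
    "a3 f g \<alpha> n = deriv (deriv g) 0 / (6 * \<kappa> ^ 3) * ((z\<^sup>2 + 2) * phi z - Phi (- z) * (z ^ 3 + 3 * z))
       - - deriv g 0 / \<kappa>\<^sup>2 * (f11 f * (2 * phi z - z * Phi (- z)) + f12 n * (phi z - z * Phi (- z)))
       - g 0 / \<kappa> * (f21 f * (z ^ 4 + 4 * z\<^sup>2 + 8) * phi z + f22 f n * (z\<^sup>2 + 2) * phi z + f23 n * phi z)"
    for n
    unfolding a1_def a2_def a3_def Let_def z_def[symmetric] Phi_z \<kappa>_def
    by (simp_all add: power_mult_distrib ring_distribs add_divide_distrib diff_divide_distrib mult_ac)
  have "(\<lambda>n. (LBINT u. indicator {0<..} u * (g (- u) * (1 - accept_prob f \<alpha> n (- u))))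
      - (a1 f g \<alpha> / sqrt (real n) + a2 f g \<alpha> n / real n + a3 f g \<alpha> n / real n powr (3 / 2)))
       \<in> O(\<lambda>n. 1 / (real n)\<^sup>2)" (is "?A'")
    unfolding coeffs_A
    by (rule smoothed_tail_expansion[OF g_int' g0 taylor_A M(1) \<kappa> L(1,3,4) pR poly_measurable
          Q_A Q_A_measurable approx_A])
  also have "?A' \<longleftrightarrow> ?A"
    by (rule landau_o.big.in_cong, use ev1 in eventually_elim) simp
  finally show ?A .
  have "\<forall>\<^sub>F n in sequentially. \<forall>t. \<forall>u\<ge>0. t = - z + \<kappa> * sqrt (real n) * u \<longrightarrow>
      \<bar>accept_prob f \<alpha> n u - (Phi (- t) - phi t * ((- f11 f * t\<^sup>2 + - f12 n) / sqrt (real n)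
          + (f21 f * t ^ 5 + f22 f n * t ^ 3 + f23 n * t) / real n
          + - poly (R n) (- t) / real n powr (3 / 2)))\<bar> \<le> C / (real n)\<^sup>2"
    using reiss
  proof eventually_elim
    case (elim n)
    show ?case
    proof (intro allI impI)
      fix t u assume t: "t = - z + \<kappa> * sqrt (real n) * u"
      have acc_eq: "accept_prob f \<alpha> n u = median_cdf f u n (- t)"
        unfolding accept_prob_eq[of f, OF f(2)] by (simp add: t z_def \<kappa>_def)
      have "Phi (- t) + phi (- t) / sqrt (real n) * (f11 f * (- t)\<^sup>2 + f12 n)
          + phi (- t) / real n * (f21 f * (- t) ^ 5 + f22 f n * (- t) ^ 3 + f23 n * - t)
          + phi (- t) * poly (R n) (- t) / real n powr (3 / 2)
        = Phi (- t) - phi t * ((- f11 f * t\<^sup>2 + - f12 n) / sqrt (real n)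
          + (f21 f * t ^ 5 + f22 f n * t ^ 3 + f23 n * t) / real n
          + - poly (R n) (- t) / real n powr (3 / 2))"
        by (simp add: phi_minus ring_distribs add_divide_distrib diff_divide_distrib mult_ac)
      with elim[rule_format, of u "- t"]
      show "\<bar>accept_prob f \<alpha> n u - (Phi (- t) - phi t * ((- f11 f * t\<^sup>2 + - f12 n) / sqrt (real n)
          + (f21 f * t ^ 5 + f22 f n * t ^ 3 + f23 n * t) / real n
          + - poly (R n) (- t) / real n powr (3 / 2)))\<bar> \<le> C / (real n)\<^sup>2"
        by (simp only: acc_eq)
    qed
  qed
  note approx_At = this
  have taylor_At: "\<bar>g v - (g 0 + deriv g 0 * v + deriv (deriv g) 0 / 2 * v\<^sup>2)\<bar> \<le> M * v ^ 3"
    if "v \<ge> 0" for v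
    using M(2)[of v] that by simp
  have pR': "\<bar>- poly (R n) (- t)\<bar> \<le> L * (1 + \<bar>t\<bar>) ^ d" for n t
    using pR[of n "- t"] by simp
  \<comment> \<open>reflected data: boundary \<open>- z\<close>, tail \<open>Phi z\<close>, negated \<open>f11\<close> and \<open>f12\<close>\<close>
  have coeffs_At: "at1 f g \<alpha> = g 0 / \<kappa> * (phi (- z) - - z * Phi (- (- z)))"
    "at2 f g \<alpha> n = deriv g 0 / (2 * \<kappa>\<^sup>2) * (Phi (- (- z)) * ((- z)\<^sup>2 + 1) - - z * phi (- z))
       - g 0 / \<kappa> * (- f11 f * (- z * phi (- z) + Phi (- (- z))) + - f12 n * Phi (- (- z)))"
    "at3 f g \<alpha> n = deriv (deriv g) 0 / (6 * \<kappa> ^ 3)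
         * (((- z)\<^sup>2 + 2) * phi (- z) - Phi (- (- z)) * ((- z) ^ 3 + 3 * - z))
       - deriv g 0 / \<kappa>\<^sup>2 * (- f11 f * (2 * phi (- z) - - z * Phi (- (- z)))
           + - f12 n * (phi (- z) - - z * Phi (- (- z))))
       - g 0 / \<kappa> * (f21 f * ((- z) ^ 4 + 4 * (- z)\<^sup>2 + 8) * phi (- z)
           + f22 f n * ((- z)\<^sup>2 + 2) * phi (- z) + f23 n * phi (- z))"
    for n
    unfolding at1_def at2_def at3_def Let_def z_def[symmetric] minus_minus Phi_z phi_minus \<kappa>_def
    by (simp_all add: power_mult_distrib ring_distribs add_divide_distrib diff_divide_distrib mult_ac)
  have "(\<lambda>n. (LBINT u. indicator {0<..} u * (g u * accept_prob f \<alpha> n u))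
      - (at1 f g \<alpha> / sqrt (real n) + at2 f g \<alpha> n / real n + at3 f g \<alpha> n / real n powr (3 / 2)))
       \<in> O(\<lambda>n. 1 / (real n)\<^sup>2)" (is "?At'")
    unfolding coeffs_At
    by (rule smoothed_tail_expansion[OF g_int g0 taylor_At M(1) \<kappa> L(2,3,4) pR' poly_measurable'
          acc accept_prob_measurable[OF f(1)] approx_At])
  also have "?At' \<longleftrightarrow> ?At"
    by (rule landau_o.big.in_cong, use ev2 in eventually_elim) simp
  finally show ?At .
qed

theorem mainTheorem3:
  fixes f g :: "real \<Rightarrow> real" and \<alpha> :: real
  assumes f_density: "prob_density f"
    and f_median: "(LBINT x:{..0}. f x) = 1 / 2"
    and f_pos: "f 0 > 0"
    and f_smooth: "\<forall>\<^sub>F x in nhds 0. f field_differentiable at x"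
      "deriv f field_differentiable at 0"
    and f_reiss: "reiss_expansion f"
    and alpha: "0 < \<alpha>" "\<alpha> < 1"
    and g_density: "prob_density g"
    and g_diff: "\<And>k x. k < 3 \<Longrightarrow> (deriv ^^ k) g field_differentiable at x"
    and g_bdd: "bounded (range ((deriv ^^ 3) g))"
    and lambda: "0 < prior_alt g" "prior_alt g < 1"
  shows
    "(\<lambda>n. err_A f g \<alpha> n
        - (a1 f g \<alpha> / sqrt (real n) + a2 f g \<alpha> n / real n + a3 f g \<alpha> n / real n powr (3 / 2)))
       \<in> O(\<lambda>n. 1 / (real n)\<^sup>2) \<and>
     (\<lambda>n. err_At f g \<alpha> n
        - (at1 f g \<alpha> / sqrt (real n) + at2 f g \<alpha> n / real n + at3 f g \<alpha> n / real n powr (3 / 2)))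
       \<in> O(\<lambda>n. 1 / (real n)\<^sup>2) \<and>
     b1 f g \<alpha> = at1 f g \<alpha> - a1 f g \<alpha> \<and>
     (\<forall>n. b2 f g \<alpha> n = at2 f g \<alpha> n - a2 f g \<alpha> n \<and> b3 f g \<alpha> n = at3 f g \<alpha> n - a3 f g \<alpha> n) \<and>
     (\<lambda>n. err_delta f g \<alpha> n
        - (c1 f g \<alpha> / sqrt (real n) + c2 f g \<alpha> n / real n + c3 f g \<alpha> n / real n powr (3 / 2)))
       \<in> O(\<lambda>n. 1 / (real n)\<^sup>2) \<and>
     (\<lambda>n. err_eps f g \<alpha> n
        - (d1 f g \<alpha> / sqrt (real n) + d2 f g \<alpha> n / real n + d3 f g \<alpha> n / real n powr (3 / 2)))
       \<in> O(\<lambda>n. 1 / (real n)\<^sup>2)"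
proof (intro conjI allI)
  note A = err_expansions(1)[OF f_density f_pos f_reiss alpha g_density g_diff g_bdd]
  note At = err_expansions(2)[OF f_density f_pos f_reiss alpha g_density g_diff g_bdd]
  note b = b_eq_at_minus_a[of f g \<alpha>]
  show "(\<lambda>n. err_A f g \<alpha> n
        - (a1 f g \<alpha> / sqrt (real n) + a2 f g \<alpha> n / real n + a3 f g \<alpha> n / real n powr (3 / 2)))
       \<in> O(\<lambda>n. 1 / (real n)\<^sup>2)" by (rule A)
  show "(\<lambda>n. err_At f g \<alpha> n
        - (at1 f g \<alpha> / sqrt (real n) + at2 f g \<alpha> n / real n + at3 f g \<alpha> n / real n powr (3 / 2)))
       \<in> O(\<lambda>n. 1 / (real n)\<^sup>2)" by (rule At)
  show "b1 f g \<alpha> = at1 f g \<alpha> - a1 f g \<alpha>" by (rule b)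
  show "b2 f g \<alpha> n = at2 f g \<alpha> n - a2 f g \<alpha> n" "b3 f g \<alpha> n = at3 f g \<alpha> n - a3 f g \<alpha> n" for n
    by (rule b)+
  define e where "e = (\<lambda>n. 1 / sqrt (real n))"
  define W where "W = (\<lambda>n. err_At f g \<alpha> n - err_A f g \<alpha> n)"
  note e_powers = inverse_sqrt_powers[folded fun_cong[OF e_def]]
  have e: "e \<longlonglongrightarrow> 0"
    unfolding e_def by (intro tendsto_divide_0[OF tendsto_const] filterlim_at_top_imp_at_infinity
        filterlim_compose[OF sqrt_at_top] filterlim_real_sequentially)
  note A' = A[unfolded e_powers mult_1_left] and At' = At[unfolded e_powers mult_1_left]
  have W: "(\<lambda>n. W n - (b1 f g \<alpha> * e n + b2 f g \<alpha> n * (e n)\<^sup>2 + b3 f g \<alpha> n * e n ^ 3)) \<in> O(\<lambda>n. e n ^ 4)"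
    using sum_in_bigo(2)[OF At' A'] unfolding W_def b by (simp add: algebra_simps)
  have W': "(\<lambda>n. - W n - (- b1 f g \<alpha> * e n + - b2 f g \<alpha> n * (e n)\<^sup>2 + - b3 f g \<alpha> n * e n ^ 3))
      \<in> O(\<lambda>n. e n ^ 4)"
    using landau_o.big.uminus_in_iff[THEN iffD2, OF W] by (simp add: algebra_simps)
  have const: "(\<lambda>_. c) \<in> O(\<lambda>_::nat. 1::real)" for c by simp
  note O1 = sum_in_bigo landau_o.big.mult_in_1 const parity_coeffs_bigo
  have bdd: "a2 f g \<alpha> \<in> O(\<lambda>_. 1)" "a3 f g \<alpha> \<in> O(\<lambda>_. 1)" "at2 f g \<alpha> \<in> O(\<lambda>_. 1)"
    "at3 f g \<alpha> \<in> O(\<lambda>_. 1)"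
    unfolding a2_def[abs_def] a3_def[abs_def] at2_def[abs_def] at3_def[abs_def] Let_def
    by (intro O1)+
  have bdd_b: "b2 f g \<alpha> \<in> O(\<lambda>_. 1)" "b3 f g \<alpha> \<in> O(\<lambda>_. 1)"
    using sum_in_bigo(2)[OF bdd(3,1)] sum_in_bigo(2)[OF bdd(4,2)] by (simp_all add: b[symmetric])
  then have bdd_b': "(\<lambda>n. - b2 f g \<alpha> n) \<in> O(\<lambda>_. 1)" "(\<lambda>n. - b3 f g \<alpha> n) \<in> O(\<lambda>_. 1)"
    by simp_all
  have "(\<lambda>n. err_A f g \<alpha> n / (prior_alt g - W n)
        - (c1 f g \<alpha> * e n + c2 f g \<alpha> n * (e n)\<^sup>2 + c3 f g \<alpha> n * e n ^ 3)) \<in> O(\<lambda>n. e n ^ 4)" (is ?D)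
    unfolding c1_def c2_def c3_def Let_def
    by (rule ratio_expansion[OF A' W bdd(1,2) bdd_b e]) (use lambda in auto)
  also have "?D \<longleftrightarrow> (\<lambda>n. err_delta f g \<alpha> n
        - (c1 f g \<alpha> * e n + c2 f g \<alpha> n * (e n)\<^sup>2 + c3 f g \<alpha> n * e n ^ 3)) \<in> O(\<lambda>n. e n ^ 4)"
    by (rule landau_o.big.in_cong, use eventually_ge_at_top[of 1] in eventually_elim)
       (simp add: err_delta_eq[OF f_density g_density] W_def)
  finally show "(\<lambda>n. err_delta f g \<alpha> n
        - (c1 f g \<alpha> / sqrt (real n) + c2 f g \<alpha> n / real n + c3 f g \<alpha> n / real n powr (3 / 2)))
       \<in> O(\<lambda>n. 1 / (real n)\<^sup>2)"
    unfolding e_powers mult_1_left .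
  have d_coeffs: "d2 f g \<alpha> n = at1 f g \<alpha> * - b1 f g \<alpha> / (1 - prior_alt g)\<^sup>2 + at2 f g \<alpha> n / (1 - prior_alt g)"
    "d3 f g \<alpha> n = at3 f g \<alpha> n / (1 - prior_alt g)
      + (at1 f g \<alpha> * - b2 f g \<alpha> n + at2 f g \<alpha> n * - b1 f g \<alpha>) / (1 - prior_alt g)\<^sup>2
      + at1 f g \<alpha> * (- b1 f g \<alpha>)\<^sup>2 / (1 - prior_alt g) ^ 3" for n
    by (simp_all add: d2_def d3_def Let_def divide_inverse algebra_simps)
  have "(\<lambda>n. err_At f g \<alpha> n / (1 - prior_alt g - - W n)
        - (d1 f g \<alpha> * e n + d2 f g \<alpha> n * (e n)\<^sup>2 + d3 f g \<alpha> n * e n ^ 3)) \<in> O(\<lambda>n. e n ^ 4)" (is ?E)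
    unfolding d1_def d_coeffs
    by (rule ratio_expansion[OF At' W' bdd(3,4) bdd_b' e]) (use lambda in auto)
  also have "?E \<longleftrightarrow> (\<lambda>n. err_eps f g \<alpha> n
        - (d1 f g \<alpha> * e n + d2 f g \<alpha> n * (e n)\<^sup>2 + d3 f g \<alpha> n * e n ^ 3)) \<in> O(\<lambda>n. e n ^ 4)"
    by (rule landau_o.big.in_cong, use eventually_ge_at_top[of 1] in eventually_elim)
       (simp add: err_eps_eq[OF f_density g_density] W_def)
  finally show "(\<lambda>n. err_eps f g \<alpha> n
        - (d1 f g \<alpha> / sqrt (real n) + d2 f g \<alpha> n / real n + d3 f g \<alpha> n / real n powr (3 / 2)))
       \<in> O(\<lambda>n. 1 / (real n)\<^sup>2)"
    unfolding e_powers mult_1_left .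
qed

end
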